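(* Let $G$ be an abelian group and $\mathbb{K}$ an algebraically closed field of characteristic zero. Let $R=A\otimes B$, where $A=UT(d_1,\dots,d_m)$ has the elementary grading induced by the $n$-tuple $(g_1,\dots,g_n)\in G^n$, and $B$ is a $\mathbb{K}$-algebra that satisfies the same ordinary identities as $M_t(\mathbb{K})$ and has a $G$-grading whose support is the subgroup $H$ of $G$. Let $\alpha:G\to G/H$ denote the canonical epimorphism. The coarsening ${}^{\alpha}R$ satisfies the same $G/H$-graded identities as the algebra $UT(d_1t,\dots,d_mt)$ with the elementary grading induced by $(g_1H,g_1H,\dots,g_nH,g_nH)$, where each coset is repeated $t$ times.
   Context: $UT(d_1,\dots,d_m)$ ($d_i$ positive integers, $n=d_1+\cdots+d_m$) is the subalgebra of $M_n(\mathbb{K})$ of block matrices $(A_{ij})_{1\le i,j\le m}$, with $A_{ij}$ of size $d_i\times d_j$ and $A_{ij}=0$ for $i>j$. The elementary grading induced by $(g_1,\dots,g_n)\in G^n$ is the one in which each matrix unit $e_{ij}$ of the algebra is homogeneous of degree $g_ig_j^{-1}$. If $B$ is a $G$-graded algebra, $A\otimes B$ has the $G$-grading in which $(A\otimes B)_g$ is spanned by the $e_{ij}\otimes b$ with $b\in B$ homogeneous and $g_i(\deg_G b)g_j^{-1}=g$. The support of a grading is the set of $g$ whose homogeneous component is nonzero. For a homomorphism $\alpha:G\to Q$ and a $G$-graded algebra $R$, the coarsening ${}^{\alpha}R$ is $R$ with the $Q$-grading $R_q=\bigoplus_{g\in\alpha^{-1}(q)}R_g$. A $Q$-graded identity of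 a $Q$-graded algebra $R$ is a polynomial in the free $Q$-graded associative algebra (variables $x_i^q$ of degree $q$) vanishing under all substitutions of the variables $x_i^q$ by elements of $R_q$. *)

theory Defs
  imports
    "HOL-Algebra.QuotRing"
    "HOL-Library.Poly_Mapping"
    "Jordan_Normal_Form.VS_Connect"
begin

section \<open>Associative algebras\<close>

text \<open>
  Algebras over a field are records of type \<open>('k, 'a) module\<close>, the scalars being the record
  \<open>class_ring\<close> of the type class field \<open>'k\<close>. They are associative but need not have a unit;
  the record field \<open>one\<close> is unconstrained and plays no role.
\<close>

locale assoc_algebra = Module.module class_ring A
  for A :: "('k :: field, 'a) module" +
  assumes mult_closed:
      "\<lbrakk>x \<in> carrier A; y \<in> carrier A\<rbrakk> \<Longrightarrow> x \<otimes>\<^bsub>A\<^esub> y \<in> carrier A"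
    and mult_assoc:
      "\<lbrakk>x \<in> carrier A; y \<in> carrier A; z \<in> carrier A\<rbrakk>
        \<Longrightarrow> (x \<otimes>\<^bsub>A\<^esub> y) \<otimes>\<^bsub>A\<^esub> z = x \<otimes>\<^bsub>A\<^esub> (y \<otimes>\<^bsub>A\<^esub> z)"
    and mult_l_distr:
      "\<lbrakk>x \<in> carrier A; y \<in> carrier A; z \<in> carrier A\<rbrakk>
        \<Longrightarrow> (x \<oplus>\<^bsub>A\<^esub> y) \<otimes>\<^bsub>A\<^esub> z = x \<otimes>\<^bsub>A\<^esub> z \<oplus>\<^bsub>A\<^esub> y \<otimes>\<^bsub>A\<^esub> z"
    and mult_r_distr:
      "\<lbrakk>x \<in> carrier A; y \<in> carrier A; z \<in> carrier A\<rbrakk>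
        \<Longrightarrow> x \<otimes>\<^bsub>A\<^esub> (y \<oplus>\<^bsub>A\<^esub> z) = x \<otimes>\<^bsub>A\<^esub> y \<oplus>\<^bsub>A\<^esub> x \<otimes>\<^bsub>A\<^esub> z"
    and smult_mult_l:
      "\<lbrakk>x \<in> carrier A; y \<in> carrier A\<rbrakk>
        \<Longrightarrow> (c \<odot>\<^bsub>A\<^esub> x) \<otimes>\<^bsub>A\<^esub> y = c \<odot>\<^bsub>A\<^esub> (x \<otimes>\<^bsub>A\<^esub> y)"
    and smult_mult_r:
      "\<lbrakk>x \<in> carrier A; y \<in> carrier A\<rbrakk>
        \<Longrightarrow> x \<otimes>\<^bsub>A\<^esub> (c \<odot>\<^bsub>A\<^esub> y) = c \<odot>\<^bsub>A\<^esub> (x \<otimes>\<^bsub>A\<^esub> y)"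

abbreviation lin_span :: "('k :: field, 'a) module \<Rightarrow> 'a set \<Rightarrow> 'a set" where
  "lin_span V S \<equiv> LinearCombinations.module.span class_ring V S"


section \<open>Polynomial identities\<close>

text \<open>
  Elements of the free associative algebra (without unit) on a set \<open>X\<close> of noncommuting
  variables: linear combinations of nonempty words over \<open>X\<close>. Omitting constant terms loses no
  identity of a nonzero unital algebra, since evaluation at zero returns the constant term.
\<close>

definition free_assoc :: "'v set \<Rightarrow> ('v list \<Rightarrow>\<^sub>0 'k :: field) set" where
  "free_assoc X = {f. \<forall>w \<in> Poly_Mapping.keys f. w \<noteq> [] \<and> set w \<subseteq> X}"

fun word_eval :: "('k, 'a) module \<Rightarrow> ('v \<Rightarrow> 'a) \<Rightarrow> 'v list \<Rightarrow> 'a" where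
  "word_eval A \<rho> [] = \<one>\<^bsub>A\<^esub>"  \<comment> \<open>arbitrary: the empty word does not occur in \<open>free_assoc\<close>\<close>
| "word_eval A \<rho> [x] = \<rho> x"
| "word_eval A \<rho> (x # y # w) = \<rho> x \<otimes>\<^bsub>A\<^esub> word_eval A \<rho> (y # w)"

definition poly_eval ::
  "('k :: field, 'a) module \<Rightarrow> ('v \<Rightarrow> 'a) \<Rightarrow> ('v list \<Rightarrow>\<^sub>0 'k) \<Rightarrow> 'a" where
  "poly_eval A \<rho> f =
    (\<Oplus>\<^bsub>A\<^esub>w \<in> Poly_Mapping.keys f. Poly_Mapping.lookup f w \<odot>\<^bsub>A\<^esub> word_eval A \<rho> w)"

definition ordinary_identities ::
  "('k :: field, 'a) module \<Rightarrow> (nat list \<Rightarrow>\<^sub>0 'k) set" where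
  "ordinary_identities A =
    {f \<in> free_assoc UNIV. \<forall>\<rho>. (\<forall>i. \<rho> i \<in> carrier A) \<longrightarrow> poly_eval A \<rho> f = \<zero>\<^bsub>A\<^esub>}"

text \<open>The pair \<open>(q, i)\<close> is the \<open>i\<close>-th variable of degree \<open>q\<close>.\<close>

definition graded_identities ::
  "('q, 'm) monoid_scheme \<Rightarrow> ('k :: field, 'a) module \<Rightarrow> ('q \<Rightarrow> 'a set)
    \<Rightarrow> (('q \<times> nat) list \<Rightarrow>\<^sub>0 'k) set" where
  "graded_identities Q A \<Gamma> =
    {f \<in> free_assoc (carrier Q \<times> UNIV).
      \<forall>\<rho>. (\<forall>q \<in> carrier Q. \<forall>i. \<rho> (q, i) \<in> \<Gamma> q) \<longrightarrow> poly_eval A \<rho> f = \<zero>\<^bsub>A\<^esub>}"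


section \<open>Gradings\<close>

text \<open>
  \<open>\<Gamma> g\<close> is the homogeneous component of degree \<open>g\<close>. The assumption \<open>direct\<close> states that the
  algebra is the direct sum of the components.
\<close>

locale graded_algebra = G?: group G + assoc_algebra A
  for G :: "('g, 'm) monoid_scheme" and A :: "('k :: field, 'a) module" +
  fixes \<Gamma> :: "'g \<Rightarrow> 'a set"
  assumes component_subspace: "g \<in> carrier G \<Longrightarrow> LinearCombinations.submodule class_ring (\<Gamma> g) A"
    and direct: "x \<in> carrier A \<Longrightarrow>
      \<exists>!c. c \<in> (\<Pi>\<^sub>E g \<in> carrier G. \<Gamma> g) \<and> finite {g \<in> carrier G. c g \<noteq> \<zero>\<^bsub>A\<^esub>} \<and>
        x = (\<Oplus>\<^bsub>A\<^esub>g \<in> {g \<in> carrier G. c g \<noteq> \<zero>\<^bsub>A\<^esub>}. c g)"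
    and mult_degree:
      "\<lbrakk>g \<in> carrier G; h \<in> carrier G; x \<in> \<Gamma> g; y \<in> \<Gamma> h\<rbrakk> \<Longrightarrow> x \<otimes>\<^bsub>A\<^esub> y \<in> \<Gamma> (g \<otimes>\<^bsub>G\<^esub> h)"

definition grading_support ::
  "('g, 'm) monoid_scheme \<Rightarrow> ('k, 'a) module \<Rightarrow> ('g \<Rightarrow> 'a set) \<Rightarrow> 'g set" where
  "grading_support G A \<Gamma> = {g \<in> carrier G. \<Gamma> g \<noteq> {\<zero>\<^bsub>A\<^esub>}}"

definition coarsening ::
  "('g, 'm) monoid_scheme \<Rightarrow> ('g \<Rightarrow> 'q) \<Rightarrow> ('k :: field, 'a) module \<Rightarrow> ('g \<Rightarrow> 'a set)
    \<Rightarrow> 'q \<Rightarrow> 'a set" where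
  "coarsening G \<alpha> A \<Gamma> q = lin_span A (\<Union>g \<in> {g \<in> carrier G. \<alpha> g = q}. \<Gamma> g)"


section \<open>Upper block triangular matrices\<close>

text \<open>
  The block in position \<open>(p, q)\<close> of a matrix with block sizes \<open>d\<close> has its upper left corner at
  row \<open>sum_list (take p d)\<close> and column \<open>sum_list (take q d)\<close>.
\<close>

definition UT :: "nat list \<Rightarrow> ('k :: field, 'k mat) module" where
  "UT d = module_mat TYPE('k) (sum_list d) (sum_list d)
    \<lparr>carrier := {M \<in> carrier_mat (sum_list d) (sum_list d).
      \<forall>p < length d. \<forall>q < p. \<forall>r < d ! p. \<forall>s < d ! q.
        M $$ (sum_list (take p d) + r, sum_list (take q d) + s) = 0}\<rparr>"

definition unit_mat :: "nat \<Rightarrow> nat \<Rightarrow> nat \<Rightarrow> 'k :: field mat" where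
  "unit_mat n i j = mat n n (\<lambda>p. if p = (i, j) then 1 else 0)"

definition elementary_grading ::
  "('g, 'm) monoid_scheme \<Rightarrow> nat list \<Rightarrow> 'g list \<Rightarrow> 'g \<Rightarrow> ('k :: field mat) set" where
  "elementary_grading G d gs g = lin_span (UT d)
    {unit_mat (sum_list d) i j | i j.
      i < sum_list d \<and> j < sum_list d \<and>
      (unit_mat (sum_list d) i j :: 'k mat) \<in> carrier (UT d) \<and>
      gs ! i \<otimes>\<^bsub>G\<^esub> inv\<^bsub>G\<^esub> (gs ! j) = g}"


section \<open>Tensor products\<close>

text \<open>
  \<open>tensor_free A B\<close> is the vector space with basis \<open>carrier A \<times> carrier B\<close>, with basis elements
  multiplied componentwise. Its quotient by the span of the bilinearity relations, which is an
  ideal, is the tensor product of the algebras.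
\<close>

definition tensor_free ::
  "('k :: field, 'a) module \<Rightarrow> ('k, 'b) module \<Rightarrow> ('k, ('a \<times> 'b) \<Rightarrow>\<^sub>0 'k) module" where
  "tensor_free A B = \<lparr>
     carrier = {f. Poly_Mapping.keys f \<subseteq> carrier A \<times> carrier B},
     mult = (\<lambda>f g. \<Sum>(a, b) \<in> Poly_Mapping.keys f. \<Sum>(a', b') \<in> Poly_Mapping.keys g.
       Poly_Mapping.single (a \<otimes>\<^bsub>A\<^esub> a', b \<otimes>\<^bsub>B\<^esub> b')
         (Poly_Mapping.lookup f (a, b) * Poly_Mapping.lookup g (a', b'))),
     one = Poly_Mapping.single (\<one>\<^bsub>A\<^esub>, \<one>\<^bsub>B\<^esub>) 1,
     zero = 0,
     add = (+),
     smult = (\<lambda>c. Poly_Mapping.map ((*) c))\<rparr>"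

definition tensor_relators ::
  "('k :: field, 'a) module \<Rightarrow> ('k, 'b) module \<Rightarrow> (('a \<times> 'b) \<Rightarrow>\<^sub>0 'k) set" where
  "tensor_relators A B =
     {Poly_Mapping.single (a \<oplus>\<^bsub>A\<^esub> a', b) 1 - Poly_Mapping.single (a, b) 1
        - Poly_Mapping.single (a', b) 1
      | a a' b. a \<in> carrier A \<and> a' \<in> carrier A \<and> b \<in> carrier B} \<union>
     {Poly_Mapping.single (a, b \<oplus>\<^bsub>B\<^esub> b') 1 - Poly_Mapping.single (a, b) 1
        - Poly_Mapping.single (a, b') 1
      | a b b'. a \<in> carrier A \<and> b \<in> carrier B \<and> b' \<in> carrier B} \<union>
     {Poly_Mapping.single (c \<odot>\<^bsub>A\<^esub> a, b) 1 - Poly_Mapping.single (a, b) c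
      | a b c. a \<in> carrier A \<and> b \<in> carrier B} \<union>
     {Poly_Mapping.single (a, c \<odot>\<^bsub>B\<^esub> b) 1 - Poly_Mapping.single (a, b) c
      | a b c. a \<in> carrier A \<and> b \<in> carrier B}"

definition tensor_ideal ::
  "('k :: field, 'a) module \<Rightarrow> ('k, 'b) module \<Rightarrow> (('a \<times> 'b) \<Rightarrow>\<^sub>0 'k) set" where
  "tensor_ideal A B = lin_span (tensor_free A B) (tensor_relators A B)"

definition tensor_algebra ::
  "('k :: field, 'a) module \<Rightarrow> ('k, 'b) module \<Rightarrow> ('k, (('a \<times> 'b) \<Rightarrow>\<^sub>0 'k) set) module" where
  "tensor_algebra A B = ring.extend (tensor_free A B Quot tensor_ideal A B)
    (module.fields (\<lambda>c X. \<Union>x \<in> X.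
      tensor_ideal A B +>\<^bsub>tensor_free A B\<^esub> (c \<odot>\<^bsub>tensor_free A B\<^esub> x)))"

definition pure_tensor ::
  "('k :: field, 'a) module \<Rightarrow> ('k, 'b) module \<Rightarrow> 'a \<Rightarrow> 'b \<Rightarrow> (('a \<times> 'b) \<Rightarrow>\<^sub>0 'k) set" where
  "pure_tensor A B a b =
    tensor_ideal A B +>\<^bsub>tensor_free A B\<^esub> Poly_Mapping.single (a, b) 1"

definition tensor_grading ::
  "('g, 'm) monoid_scheme \<Rightarrow> nat list \<Rightarrow> 'g list \<Rightarrow> ('k :: field, 'b) module \<Rightarrow> ('g \<Rightarrow> 'b set)
    \<Rightarrow> 'g \<Rightarrow> (('k mat \<times> 'b) \<Rightarrow>\<^sub>0 'k) set set" where
  "tensor_grading G d gs B \<Gamma> g = lin_span (tensor_algebra (UT d) B)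
    {pure_tensor (UT d) B (unit_mat (sum_list d) i j) b | i j h b.
      i < sum_list d \<and> j < sum_list d \<and>
      (unit_mat (sum_list d) i j :: 'k mat) \<in> carrier (UT d) \<and>
      h \<in> carrier G \<and> b \<in> \<Gamma> h \<and>
      gs ! i \<otimes>\<^bsub>G\<^esub> h \<otimes>\<^bsub>G\<^esub> inv\<^bsub>G\<^esub> (gs ! j) = g}"

end

theory Submission
  imports Defs
begin

text \<open>
  After coarsening, the degree of \<open>e\<^sub>i\<^sub>j \<otimes> b\<close> no longer depends on \<open>b\<close>. Hence both algebras consist of
  the matrices with a prescribed block triangular zero pattern over a coefficient algebra, \<open>B\<close> or
  \<open>M\<^sub>t(K)\<close>, and a component of either grading consists of all matrices supported on a set of
  positions that is the same for both. Substituting such matrices with independent entries into a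
  graded polynomial, each entry of the result is an ordinary polynomial in these entries, with the
  same formula on both sides. So being a graded identity depends only on the ordinary identities of
  the coefficient algebra. No multilinearity is involved. For the tensor product, the matrix entries
  are obtained from the linear map \<open>a \<otimes> b \<mapsto> (a\<^sub>i\<^sub>j b)\<close>, whose kernel on the free space is exactly
  the ideal of bilinearity relations.
\<close>

section \<open>Sums and words in associative algebras\<close>

text \<open>The degree of \<open>e_ij \<otimes> b\<close> becomes independent of b for two reasons:
  a nonzero homogeneous b has its degree h in the support H, and commutativity turns g_i h g_j^{-1}
  into h g_i g_j^{-1}, whose coset does not see h. What remains of the grading of B is that every
  element is a finite sum of homogeneous ones. B is known only through its ordinary identities, so
  the two algebras are not compared by a map. What they share is combinatorial: the size n, the
  triangular pattern and the set of positions of each degree. A locale isolates what must be known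
  about the entries, and the comparison is made there once and used in both directions. The
  variables of the entry polynomials are pairs of a graded variable and a position, whereas ordinary
  identities are written in variables numbered by naturals. Only finitely many variables occur in
  one polynomial, so a renumbering bridges this.\<close>

context assoc_algebra
begin

lemma smult_0_left [simp]: "x \<in> carrier A \<Longrightarrow> 0 \<odot>\<^bsub>A\<^esub> x = \<zero>\<^bsub>A\<^esub>"
  using lmult_0[of x] by simp

lemma smult_1_left [simp]: "x \<in> carrier A \<Longrightarrow> 1 \<odot>\<^bsub>A\<^esub> x = x"
  using smult_one[of x] by simp

text \<open>Homogeneity at the scalar 0: the zero vector is 0 times itself, so the product is 0
  times an element.\<close>

lemma zero_mult [simp]: "x \<in> carrier A \<Longrightarrow> \<zero>\<^bsub>A\<^esub> \<otimes>\<^bsub>A\<^esub> x = \<zero>\<^bsub>A\<^esub>"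
  using smult_mult_l[of "\<zero>\<^bsub>A\<^esub>" x 0] by (simp add: mult_closed)

lemma mult_zero [simp]: "x \<in> carrier A \<Longrightarrow> x \<otimes>\<^bsub>A\<^esub> \<zero>\<^bsub>A\<^esub> = \<zero>\<^bsub>A\<^esub>"
  using smult_mult_r[of x "\<zero>\<^bsub>A\<^esub>" 0] by (simp add: mult_closed)

lemma finsum_mult_left:
  assumes "finite S" "x \<in> carrier A" "f \<in> S \<rightarrow> carrier A"
  shows "x \<otimes>\<^bsub>A\<^esub> (\<Oplus>\<^bsub>A\<^esub>s\<in>S. f s) = (\<Oplus>\<^bsub>A\<^esub>s\<in>S. x \<otimes>\<^bsub>A\<^esub> f s)"
  using assms(1,3)
proof (induction S rule: finite_induct)
  case (insert s S)
  then have "f s \<in> carrier A" "f \<in> S \<rightarrow> carrier A" by auto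
  then show ?case
    using insert assms(2) by (simp add: mult_r_distr mult_closed finsum_closed Pi_def)
qed (use assms(2) in simp)

lemma finsum_mult_right:
  assumes "finite S" "x \<in> carrier A" "f \<in> S \<rightarrow> carrier A"
  shows "(\<Oplus>\<^bsub>A\<^esub>s\<in>S. f s) \<otimes>\<^bsub>A\<^esub> x = (\<Oplus>\<^bsub>A\<^esub>s\<in>S. f s \<otimes>\<^bsub>A\<^esub> x)"
  using assms(1,3)
proof (induction S rule: finite_induct)
  case (insert s S)
  then have "f s \<in> carrier A" "f \<in> S \<rightarrow> carrier A" by auto
  then show ?case
    using insert assms(2) by (simp add: mult_l_distr mult_closed finsum_closed Pi_def)
qed (use assms(2) in simp)

end

section \<open>Evaluation of words, and polynomials pulled back along maps of words\<close>

lemma word_eval_map: "word_eval A \<beta> (map e w) = word_eval A (\<beta> \<circ> e) w"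
  by (induction A "\<beta> \<circ> e" w rule: word_eval.induct) auto

lemma word_eval_cong: "(\<And>x. x \<in> set w \<Longrightarrow> \<beta> x = \<gamma> x) \<Longrightarrow> word_eval A \<beta> w = word_eval A \<gamma> w"
  by (induction A \<beta> w rule: word_eval.induct) auto

lemma word_eval_Cons: "w \<noteq> [] \<Longrightarrow> word_eval A \<beta> (x # w) = \<beta> x \<otimes>\<^bsub>A\<^esub> word_eval A \<beta> w"
  by (cases w) auto

text \<open>Closure under products is a premise instead of a locale assumption so that the lemma
  also covers the algebras with matrix coordinates below, of which only module laws and closure are
  assumed.\<close>

lemma word_eval_closed:
  assumes "\<And>x y. x \<in> carrier A \<Longrightarrow> y \<in> carrier A \<Longrightarrow> x \<otimes>\<^bsub>A\<^esub> y \<in> carrier A"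
    and "w \<noteq> []" "\<And>x. x \<in> set w \<Longrightarrow> \<beta> x \<in> carrier A"
  shows "word_eval A \<beta> w \<in> carrier A"
  using assms(2,3) by (induction w rule: list_nonempty_induct) (auto simp: word_eval_Cons assms(1))

lemma (in assoc_algebra) poly_eval_cong:
  assumes "f \<in> free_assoc X" "\<And>x. x \<in> X \<Longrightarrow> \<gamma> x \<in> carrier A"
    and "\<And>w x. w \<in> Poly_Mapping.keys f \<Longrightarrow> x \<in> set w \<Longrightarrow> \<beta> x = \<gamma> x"
  shows "poly_eval A \<beta> f = poly_eval A \<gamma> f"
proof -
  have "word_eval A \<beta> w = word_eval A \<gamma> w" "word_eval A \<gamma> w \<in> carrier A"
    if "w \<in> Poly_Mapping.keys f" for w
    using assms that
    by (auto simp: free_assoc_def subset_iff intro!: word_eval_cong word_eval_closed mult_closed)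
  then show ?thesis
    unfolding poly_eval_def by (auto intro!: finsum_cong')
qed

text \<open>Each word is replaced by the sum of its preimages in U. Both substitutions of the proof
  have this shape: renaming variables, where the fibres are singletons, and passing to a matrix
  entry, where they consist of index paths. The support is finite if the fibres over the words of f
  are; hence the finiteness premises below.\<close>

definition pull_poly :: "('u \<Rightarrow> 'w) \<Rightarrow> 'u set \<Rightarrow> ('w \<Rightarrow>\<^sub>0 'k :: zero) \<Rightarrow> ('u \<Rightarrow>\<^sub>0 'k)" where
  "pull_poly \<pi> U f = Abs_poly_mapping (\<lambda>u. if u \<in> U then Poly_Mapping.lookup f (\<pi> u) else 0)"

lemma lookup_pull_poly:
  assumes "finite {u \<in> U. \<pi> u \<in> Poly_Mapping.keys f}"
  shows "Poly_Mapping.lookup (pull_poly \<pi> U f) u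
    = (if u \<in> U then Poly_Mapping.lookup f (\<pi> u) else 0)"
proof -
  have "{u. (if u \<in> U then Poly_Mapping.lookup f (\<pi> u) else 0) \<noteq> 0}
      = {u \<in> U. \<pi> u \<in> Poly_Mapping.keys f}"
    by (auto simp: in_keys_iff)
  then show ?thesis
    unfolding pull_poly_def using assms by (subst Abs_poly_mapping_inverse) auto
qed

lemma keys_pull_poly:
  assumes "finite {u \<in> U. \<pi> u \<in> Poly_Mapping.keys f}"
  shows "Poly_Mapping.keys (pull_poly \<pi> U f) = {u \<in> U. \<pi> u \<in> Poly_Mapping.keys f}"
  by (auto simp: in_keys_iff lookup_pull_poly[OF assms] split: if_splits)

text \<open>Fibres over different words are disjoint and the coefficient is constant on each, so the
  sum over all preimages splits and the coefficient factors out.\<close>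

lemma (in assoc_algebra) poly_eval_pull_poly:
  assumes fin: "\<And>w. w \<in> Poly_Mapping.keys f \<Longrightarrow> finite {u \<in> U. \<pi> u = w}"
    and ne: "[] \<notin> U" and \<beta>: "\<And>x. \<beta> x \<in> carrier A"
  shows "poly_eval A \<beta> (pull_poly \<pi> U f)
    = (\<Oplus>\<^bsub>A\<^esub>w \<in> Poly_Mapping.keys f.
        Poly_Mapping.lookup f w \<odot>\<^bsub>A\<^esub> (\<Oplus>\<^bsub>A\<^esub>u \<in> {u \<in> U. \<pi> u = w}. word_eval A \<beta> u))"
proof -
  let ?K = "Poly_Mapping.keys f"
  have K: "{u \<in> U. \<pi> u \<in> ?K} = (\<Union>w\<in>?K. {u \<in> U. \<pi> u = w})" by auto
  have F: "finite {u \<in> U. \<pi> u \<in> ?K}" unfolding K using fin by auto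
  have cl: "word_eval A \<beta> u \<in> carrier A" if "u \<in> U" for u
    using that ne \<beta> by (intro word_eval_closed mult_closed) auto
  have "poly_eval A \<beta> (pull_poly \<pi> U f)
      = (\<Oplus>\<^bsub>A\<^esub>u \<in> (\<Union>w\<in>?K. {u \<in> U. \<pi> u = w}). Poly_Mapping.lookup f (\<pi> u) \<odot>\<^bsub>A\<^esub> word_eval A \<beta> u)"
    unfolding poly_eval_def keys_pull_poly[OF F] K[symmetric]
    by (intro finsum_cong') (auto simp: lookup_pull_poly[OF F] cl)
  also have "\<dots> = (\<Oplus>\<^bsub>A\<^esub>w \<in> ?K. \<Oplus>\<^bsub>A\<^esub>u \<in> {u \<in> U. \<pi> u = w}.
      Poly_Mapping.lookup f (\<pi> u) \<odot>\<^bsub>A\<^esub> word_eval A \<beta> u)"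
    by (intro add.finprod_UN_disjoint) (auto simp: fin cl pairwise_def disjnt_def)
  also have "\<dots> = (\<Oplus>\<^bsub>A\<^esub>w \<in> ?K. Poly_Mapping.lookup f w \<odot>\<^bsub>A\<^esub>
      (\<Oplus>\<^bsub>A\<^esub>u \<in> {u \<in> U. \<pi> u = w}. word_eval A \<beta> u))"
  proof (intro finsum_cong' refl)
    fix w assume w: "w \<in> ?K"
    show "(\<Oplus>\<^bsub>A\<^esub>u \<in> {u \<in> U. \<pi> u = w}. Poly_Mapping.lookup f (\<pi> u) \<odot>\<^bsub>A\<^esub> word_eval A \<beta> u)
        = Poly_Mapping.lookup f w \<odot>\<^bsub>A\<^esub> (\<Oplus>\<^bsub>A\<^esub>u \<in> {u \<in> U. \<pi> u = w}. word_eval A \<beta> u)"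
      by (subst finsum_smult) (auto simp: fin[OF w] cl intro!: finsum_cong')
  qed (auto intro!: finsum_closed cl smult_closed)
  finally show ?thesis .
qed

text \<open>Ordinary identities use variables numbered by naturals, while f may use variables of any
  type. Only finitely many occur in f, so they can be numbered injectively; the renamed polynomial
  is an identity of A, hence of C.\<close>

lemma identity_transfer:
  fixes A :: "('k :: field, 'a) module" and C :: "('k, 'c) module" and f :: "'v list \<Rightarrow>\<^sub>0 'k"
  assumes "assoc_algebra A" "assoc_algebra C"
    and sub: "ordinary_identities A \<subseteq> ordinary_identities C"
    and f: "f \<in> free_assoc UNIV"
    and van: "\<And>\<beta>. (\<And>x. \<beta> x \<in> carrier A) \<Longrightarrow> poly_eval A \<beta> f = \<zero>\<^bsub>A\<^esub>"
    and \<gamma>: "\<And>x. \<gamma> x \<in> carrier C"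
  shows "poly_eval C \<gamma> f = \<zero>\<^bsub>C\<^esub>"
proof -
  interpret C: assoc_algebra C by fact
  define X where "X = (\<Union>w \<in> Poly_Mapping.keys f. set w)"
  have "finite X" unfolding X_def by auto
  then obtain e :: "'v \<Rightarrow> nat" where e: "inj_on e X"
    using finite_imp_inj_to_nat_seg by blast
  define r where "r = inv_into X e"
  have r: "r (e x) = x" if "x \<in> X" for x using e that by (simp add: r_def)
  have in_X: "x \<in> X" if "w \<in> Poly_Mapping.keys f" "x \<in> set w" for w x
    using that by (auto simp: X_def)
  have re: "map r (map e w) = w" if "w \<in> Poly_Mapping.keys f" for w
    unfolding map_map by (intro map_idI) (simp add: r in_X[OF that])
  \<comment> \<open>\<open>r\<close> inverts \<open>e\<close> only on X, so further words over the
    naturals may also map to words of f. Restricting to U leaves exactly one preimage of each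
    word.\<close>
  define U where "U = map e ` Poly_Mapping.keys f"
  define g where "g = pull_poly (map r) U f"
  have U: "{u \<in> U. map r u = w} = {map e w}" if "w \<in> Poly_Mapping.keys f" for w
    using that re unfolding U_def by auto
  have finU: "finite {u \<in> U. map r u \<in> Poly_Mapping.keys f}" unfolding U_def by simp
  have ne: "[] \<notin> U" using f unfolding U_def free_assoc_def by auto
  have ev: "poly_eval E \<beta> g = poly_eval E (\<beta> \<circ> e) f"
    if E: "assoc_algebra E" and \<beta>: "\<And>x. \<beta> x \<in> carrier E"
    for E :: "('k, 'e) module" and \<beta>
  proof -
    interpret E: assoc_algebra E by fact
    have cl: "word_eval E \<beta> (map e w) \<in> carrier E" if "w \<in> Poly_Mapping.keys f" for w
      using that f \<beta> by (intro word_eval_closed E.mult_closed) (auto simp: free_assoc_def)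
    show ?thesis
      unfolding g_def
      by (subst E.poly_eval_pull_poly[OF _ ne \<beta>])
        (auto simp: U poly_eval_def word_eval_map[symmetric] cl intro!: E.finsum_cong')
  qed
  have "Poly_Mapping.keys g \<subseteq> U"
    unfolding g_def keys_pull_poly[OF finU] by auto
  then have gfree: "g \<in> free_assoc UNIV"
    unfolding free_assoc_def using ne by auto
  have "g \<in> ordinary_identities A"
    unfolding ordinary_identities_def using gfree by (auto simp: ev[OF assms(1)] van)
  then have g: "g \<in> ordinary_identities C" using sub by blast
  \<comment> \<open>A substitution must be total: numbers that name no variable of f receive the
    value of \<gamma> at an arbitrary variable, which still lies in C.\<close>
  have "poly_eval C \<gamma> f = poly_eval C ((\<lambda>m. \<gamma> (r m)) \<circ> e) f"
    using f \<gamma> by (intro C.poly_eval_cong[of _ UNIV]) (auto simp: r in_X)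
  also have "\<dots> = poly_eval C (\<lambda>m. \<gamma> (r m)) g"
    by (subst ev[OF assms(2)]) (auto simp: \<gamma>)
  also have "\<dots> = \<zero>\<^bsub>C\<^esub>" using g \<gamma> by (auto simp: ordinary_identities_def)
  finally show ?thesis .
qed

section \<open>Algebras with matrix coordinates\<close>

text \<open>Consecutive letters must share an index, as in a nonzero product of matrix units, and
  every position must be allowed for its letter. The empty list closes the recursion by forcing the
  last column to be j.\<close>

fun index_path :: "('v \<Rightarrow> (nat \<times> nat) set) \<Rightarrow> nat \<Rightarrow> nat \<Rightarrow> ('v \<times> nat \<times> nat) list \<Rightarrow> bool" where
  "index_path D i j [] \<longleftrightarrow> i = j"
| "index_path D i j ((v, p) # u) \<longleftrightarrow> p \<in> D v \<and> fst p = i \<and> index_path D (snd p) j u"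

text \<open>
  The \<open>(i, j)\<close> entry of a product of matrices, the \<open>v\<close>-th of which is supported on \<open>D v\<close>, is the sum
  over these lifts of the word, the letter \<open>(v, k, l)\<close> standing for the \<open>(k, l)\<close> entry of the matrix \<open>v\<close>.
\<close>

definition path_lifts ::
  "('v \<Rightarrow> (nat \<times> nat) set) \<Rightarrow> nat \<Rightarrow> nat \<Rightarrow> 'v list \<Rightarrow> ('v \<times> nat \<times> nat) list set" where
  "path_lifts D i j w = {u. u \<noteq> [] \<and> index_path D i j u \<and> map fst u = w}"

lemma path_lifts_single: "path_lifts D i j [v] = (if (i, j) \<in> D v then {[(v, i, j)]} else {})"
  unfolding path_lifts_def by (auto simp: map_eq_Cons_conv)

text \<open>The split is by the column k of the first letter, which is the summation index of the
  matrix product; the bound on D makes the union finite.\<close>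

lemma path_lifts_Cons:
  assumes "w \<noteq> []" "D v \<subseteq> {..<n} \<times> {..<n}"
  shows "path_lifts D i j (v # w)
    = (\<Union>k<n. if (i, k) \<in> D v then Cons (v, i, k) ` path_lifts D k j w else {})"
  using assms unfolding path_lifts_def
  by (auto simp: map_eq_Cons_conv image_iff split: if_splits)

lemma finite_path_lifts:
  assumes "\<And>v. v \<in> set w \<Longrightarrow> D v \<subseteq> {..<n} \<times> {..<n}" "w \<noteq> []"
  shows "finite (path_lifts D i j w)"
  using assms(2,1)
  by (induction w arbitrary: i rule: list_nonempty_induct)
    (auto simp: path_lifts_single path_lifts_Cons[where n = n])

text \<open>The assumptions make \<open>entry\<close> a bijection from R onto the matrices over C
  supported on T, compatible with the operations. Little is asked of the product of R because
  \<open>word_eval\<close> nests to the right: expanding one factor at a time uses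
  \<open>entry_mult\<close> and the laws of C. This saves work for a quotient such as the tensor
  product.\<close>

locale matrix_coordinates =
  R: Module.module class_ring R + C: assoc_algebra C
  for R :: "('k :: field, 'r) module" and C :: "('k, 'c) module" +
  fixes n :: nat and T :: "(nat \<times> nat) set" and entry :: "'r \<Rightarrow> nat \<times> nat \<Rightarrow> 'c"
  assumes mult_closed: "x \<in> carrier R \<Longrightarrow> y \<in> carrier R \<Longrightarrow> x \<otimes>\<^bsub>R\<^esub> y \<in> carrier R"
    and T_subset: "T \<subseteq> {..<n} \<times> {..<n}"
    and entry_closed: "x \<in> carrier R \<Longrightarrow> entry x p \<in> carrier C"
    and entry_outside: "x \<in> carrier R \<Longrightarrow> p \<notin> T \<Longrightarrow> entry x p = \<zero>\<^bsub>C\<^esub>"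
    and entry_add: "x \<in> carrier R \<Longrightarrow> y \<in> carrier R
      \<Longrightarrow> entry (x \<oplus>\<^bsub>R\<^esub> y) p = entry x p \<oplus>\<^bsub>C\<^esub> entry y p"
    and entry_smult: "x \<in> carrier R \<Longrightarrow> entry (c \<odot>\<^bsub>R\<^esub> x) p = c \<odot>\<^bsub>C\<^esub> entry x p"
    and entry_mult: "x \<in> carrier R \<Longrightarrow> y \<in> carrier R \<Longrightarrow> i < n \<Longrightarrow> j < n
      \<Longrightarrow> entry (x \<otimes>\<^bsub>R\<^esub> y) (i, j) = (\<Oplus>\<^bsub>C\<^esub>k\<in>{..<n}. entry x (i, k) \<otimes>\<^bsub>C\<^esub> entry y (k, j))"
    and entry_inj: "x \<in> carrier R \<Longrightarrow> y \<in> carrier R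
      \<Longrightarrow> (\<And>p. p \<in> T \<Longrightarrow> entry x p = entry y p) \<Longrightarrow> x = y"
    and entry_surj: "(\<And>p. p \<in> T \<Longrightarrow> b p \<in> carrier C)
      \<Longrightarrow> \<exists>x\<in>carrier R. \<forall>p\<in>T. entry x p = b p"
begin

definition component :: "(nat \<times> nat) set \<Rightarrow> 'r set" where
  "component D = {x \<in> carrier R. \<forall>p. p \<notin> D \<longrightarrow> entry x p = \<zero>\<^bsub>C\<^esub>}"

lemma component_zero: "x \<in> component D \<Longrightarrow> p \<notin> D \<Longrightarrow> entry x p = \<zero>\<^bsub>C\<^esub>"
  by (simp add: component_def del: split_paired_All)

lemma entry_zero: "entry \<zero>\<^bsub>R\<^esub> p = \<zero>\<^bsub>C\<^esub>"
  using entry_smult[of "\<zero>\<^bsub>R\<^esub>" 0 p] R.lmult_0[of "\<zero>\<^bsub>R\<^esub>"] entry_closed[of "\<zero>\<^bsub>R\<^esub>"] by simp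

lemma entry_finsum:
  assumes "finite S" "f \<in> S \<rightarrow> carrier R"
  shows "entry (\<Oplus>\<^bsub>R\<^esub>s\<in>S. f s) p = (\<Oplus>\<^bsub>C\<^esub>s\<in>S. entry (f s) p)"
  using assms
proof (induction S rule: finite_induct)
  case (insert s S)
  then have "f s \<in> carrier R" "f \<in> S \<rightarrow> carrier R" by auto
  then show ?case
    using insert by (simp add: entry_add entry_closed R.finsum_closed Pi_def)
qed (simp add: entry_zero)

text \<open>Induction on the word. In the sum over the middle index k, terms with (i, k) outside
  \<open>D v\<close> vanish because the first factor is supported there; in the others, prepending
  (v, i, k) to the lifts of the remaining word gives the lifts through k.\<close>

lemma entry_word_eval:
  assumes w: "w \<noteq> []" "\<And>v. v \<in> set w \<Longrightarrow> D v \<subseteq> T \<and> \<rho> v \<in> component (D v)"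
    and ij: "i < n" "j < n"
  shows "entry (word_eval R \<rho> w) (i, j)
    = (\<Oplus>\<^bsub>C\<^esub>u \<in> path_lifts D i j w. word_eval C (\<lambda>(v, p). entry (\<rho> v) p) u)"
  using w ij
proof (induction w arbitrary: i rule: list_nonempty_induct)
  case (single v)
  then show ?case
    by (auto simp: path_lifts_single component_def entry_closed)
next
  case (cons v w)
  let ?\<beta> = "\<lambda>(v, p). entry (\<rho> v) p"
  have \<rho>: "\<rho> v \<in> carrier R" "\<And>v'. v' \<in> set w \<Longrightarrow> \<rho> v' \<in> carrier R"
    and D: "D v \<subseteq> {..<n} \<times> {..<n}" "\<And>v. v \<in> set w \<Longrightarrow> D v \<subseteq> {..<n} \<times> {..<n}"
    using cons.prems(1) T_subset by (fastforce simp: component_def)+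
  have cl: "word_eval C ?\<beta> u \<in> carrier C" if "u \<in> path_lifts D k j w" for u k
    using that \<rho>(2)
    by (intro word_eval_closed C.mult_closed) (force simp: path_lifts_def intro: entry_closed)+
  have ne: "u \<noteq> []" if "u \<in> path_lifts D k j w" for u k
    using that by (simp add: path_lifts_def)
  have wC: "word_eval C ?\<beta> ((v, i, k) # u) = entry (\<rho> v) (i, k) \<otimes>\<^bsub>C\<^esub> word_eval C ?\<beta> u"
    if "u \<in> path_lifts D k j w" for u k
    by (simp add: word_eval_Cons[OF ne[OF that]])
  have fin: "finite (path_lifts D k j w)" for k
    by (rule finite_path_lifts[OF D(2) cons.hyps]) auto
  define P where "P k = (if (i, k) \<in> D v then Cons (v, i, k) ` path_lifts D k j w else {})" for k
  have clP: "word_eval C ?\<beta> u \<in> carrier C" if "u \<in> P k" for u k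
    using that cl \<rho>(1) \<open>w \<noteq> []\<close>
    by (auto simp: P_def path_lifts_def word_eval_Cons intro!: C.mult_closed entry_closed split: if_splits)
  have finP: "finite (P k)" for k by (simp add: P_def fin)
  have "entry (word_eval R \<rho> (v # w)) (i, j)
      = (\<Oplus>\<^bsub>C\<^esub>k\<in>{..<n}. entry (\<rho> v) (i, k) \<otimes>\<^bsub>C\<^esub> entry (word_eval R \<rho> w) (k, j))"
    unfolding word_eval_Cons[OF \<open>w \<noteq> []\<close>]
    by (intro entry_mult \<rho> word_eval_closed mult_closed cons) auto
  also have "\<dots> = (\<Oplus>\<^bsub>C\<^esub>k\<in>{..<n}. \<Oplus>\<^bsub>C\<^esub>u\<in>P k. word_eval C ?\<beta> u)"
  proof (intro C.finsum_cong' refl)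
    fix k assume "k \<in> {..<n}"
    then have IH: "entry (word_eval R \<rho> w) (k, j) = (\<Oplus>\<^bsub>C\<^esub>u \<in> path_lifts D k j w. word_eval C ?\<beta> u)"
      using cons by simp
    show "entry (\<rho> v) (i, k) \<otimes>\<^bsub>C\<^esub> entry (word_eval R \<rho> w) (k, j) = (\<Oplus>\<^bsub>C\<^esub>u\<in>P k. word_eval C ?\<beta> u)"
    proof (cases "(i, k) \<in> D v")
      case True
      have "entry (\<rho> v) (i, k) \<otimes>\<^bsub>C\<^esub> entry (word_eval R \<rho> w) (k, j)
          = (\<Oplus>\<^bsub>C\<^esub>u \<in> path_lifts D k j w. entry (\<rho> v) (i, k) \<otimes>\<^bsub>C\<^esub> word_eval C ?\<beta> u)"
        unfolding IH using cl \<rho> by (intro C.finsum_mult_left fin entry_closed) auto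
      also have "\<dots> = (\<Oplus>\<^bsub>C\<^esub>u \<in> path_lifts D k j w. word_eval C ?\<beta> ((v, i, k) # u))"
        by (intro C.finsum_cong' refl)
          (simp_all add: wC Pi_iff C.mult_closed entry_closed \<rho> cl)
      also have "\<dots> = (\<Oplus>\<^bsub>C\<^esub>u\<in>P k. word_eval C ?\<beta> u)"
        using True clP[of _ k] unfolding P_def
        by (simp, subst C.finsum_reindex) (auto simp: P_def)
      finally show ?thesis .
    next
      case False
      then have "entry (\<rho> v) (i, k) = \<zero>\<^bsub>C\<^esub>" using cons.prems(1)[of v] by (auto simp: component_def)
      then show ?thesis using False cl unfolding IH P_def
        by (simp add: C.finsum_closed Pi_def)
    qed
  qed (auto intro!: C.finsum_closed clP)
  \<comment> \<open>Lifts in different \<open>P k\<close> differ in the column of their first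
    letter, so the union is disjoint.\<close>
  also have "\<dots> = (\<Oplus>\<^bsub>C\<^esub>u\<in>(\<Union>k<n. P k). word_eval C ?\<beta> u)"
  proof (rule C.add.finprod_UN_disjoint[symmetric])
    show "pairwise (\<lambda>k l. disjnt (P k) (P l)) {..<n}"
      by (auto simp: pairwise_def disjnt_def P_def)
  qed (auto intro: finP clP)
  also have "(\<Union>k<n. P k) = path_lifts D i j (v # w)"
    unfolding P_def by (rule path_lifts_Cons[where D = D and v = v and n = n, symmetric]) (fact cons.hyps D)+
  finally show ?case .
qed

text \<open>
  The entries of a homogeneous element may be chosen freely on \<open>D q\<close>, so a graded polynomial vanishes
  iff its finitely many matrix entries are identities of the coefficient algebra \<open>C\<close>.
\<close>

lemma graded_identities_iff:
  fixes D :: "'q \<Rightarrow> (nat \<times> nat) set" and Q :: "('q, 'm) monoid_scheme"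
  assumes D: "\<And>q. q \<in> carrier Q \<Longrightarrow> D q \<subseteq> T"
    and \<Gamma>: "\<And>q. q \<in> carrier Q \<Longrightarrow> \<Gamma> q = component (D q)"
    and f: "f \<in> free_assoc (carrier Q \<times> UNIV)"
  shows "f \<in> graded_identities Q R \<Gamma> \<longleftrightarrow>
    (\<forall>i<n. \<forall>j<n. \<forall>\<beta>. (\<forall>x. \<beta> x \<in> carrier C) \<longrightarrow>
      poly_eval C \<beta> (pull_poly (map fst) {u. u \<noteq> [] \<and> index_path (D \<circ> fst) i j u} f) = \<zero>\<^bsub>C\<^esub>)"
proof -
  let ?F = "\<lambda>i j. pull_poly (map fst) {u. u \<noteq> [] \<and> index_path (D \<circ> fst) i j u} f"
  have f': "w \<noteq> []" "\<And>v. v \<in> set w \<Longrightarrow> fst v \<in> carrier Q"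
    if "w \<in> Poly_Mapping.keys f" for w
    using f that by (fastforce simp: free_assoc_def)+
  have lifts: "{u \<in> {u. u \<noteq> [] \<and> index_path (D \<circ> fst) i j u}. map fst u = w}
      = path_lifts (D \<circ> fst) i j w" for i j w
    by (auto simp: path_lifts_def)
  have fin: "finite (path_lifts (D \<circ> fst) i j w)" if "w \<in> Poly_Mapping.keys f" for i j w
    using f'[OF that] D T_subset by (intro finite_path_lifts[of _ _ n]) fastforce+
  have comp: "(\<forall>q\<in>carrier Q. \<forall>i. \<rho> (q, i) \<in> \<Gamma> q)
      \<longleftrightarrow> (\<forall>v. fst v \<in> carrier Q \<longrightarrow> \<rho> v \<in> component (D (fst v)))" for \<rho>
    using \<Gamma> by auto
  \<comment> \<open>\<beta> and the entries of \<rho> are compared only at positions in D, since no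
    lift visits another one. This weak link suits both directions: one builds \<rho> from \<beta>,
    the other \<beta> from \<rho>.\<close>
  have evF: "poly_eval C \<beta> (?F i j) = entry (poly_eval R \<rho> f) (i, j)"
    if \<rho>: "\<And>v. fst v \<in> carrier Q \<Longrightarrow> \<rho> v \<in> component (D (fst v))" and ij: "i < n" "j < n"
      and \<beta>: "\<And>x. \<beta> x \<in> carrier C"
      and agree: "\<And>v p. fst v \<in> carrier Q \<Longrightarrow> p \<in> D (fst v) \<Longrightarrow> \<beta> (v, p) = entry (\<rho> v) p"
    for \<rho> \<beta> i j
  proof -
    have w: "word_eval R \<rho> w \<in> carrier R"
      "entry (word_eval R \<rho> w) (i, j) = (\<Oplus>\<^bsub>C\<^esub>u \<in> path_lifts (D \<circ> fst) i j w. word_eval C \<beta> u)"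
      if "w \<in> Poly_Mapping.keys f" for w
    proof -
      show "word_eval R \<rho> w \<in> carrier R"
        using f'[OF that] \<rho> by (intro word_eval_closed mult_closed) (auto simp: component_def)
      have "entry (word_eval R \<rho> w) (i, j)
          = (\<Oplus>\<^bsub>C\<^esub>u \<in> path_lifts (D \<circ> fst) i j w. word_eval C (\<lambda>(v, p). entry (\<rho> v) p) u)"
        using f'[OF that] \<rho> D ij by (intro entry_word_eval) auto
      also have "\<dots> = (\<Oplus>\<^bsub>C\<^esub>u \<in> path_lifts (D \<circ> fst) i j w. word_eval C \<beta> u)"
      proof (intro C.finsum_cong' refl)
        fix u assume u: "u \<in> path_lifts (D \<circ> fst) i j w"
        have path: "p \<in> D (fst v)" if "index_path (D \<circ> fst) i j u" "(v, p) \<in> set u" for v p i u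
          using that by (induction u arbitrary: i) auto
        show "word_eval C (\<lambda>(v, p). entry (\<rho> v) p) u = word_eval C \<beta> u"
          using u f'[OF that]
          by (intro word_eval_cong) (force simp: path_lifts_def agree dest: path)
      qed (use \<beta> in \<open>auto simp: path_lifts_def intro!: word_eval_closed C.mult_closed\<close>)
      finally show "entry (word_eval R \<rho> w) (i, j)
        = (\<Oplus>\<^bsub>C\<^esub>u \<in> path_lifts (D \<circ> fst) i j w. word_eval C \<beta> u)" .
    qed
    have cl: "(\<Oplus>\<^bsub>C\<^esub>u \<in> path_lifts (D \<circ> fst) i j w. word_eval C \<beta> u) \<in> carrier C" for w
      using \<beta> by (auto simp: path_lifts_def intro!: C.finsum_closed word_eval_closed C.mult_closed)
    have "poly_eval C \<beta> (?F i j) = (\<Oplus>\<^bsub>C\<^esub>w \<in> Poly_Mapping.keys f. Poly_Mapping.lookup f w \<odot>\<^bsub>C\<^esub>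
        (\<Oplus>\<^bsub>C\<^esub>u \<in> path_lifts (D \<circ> fst) i j w. word_eval C \<beta> u))"
      unfolding lifts[symmetric]
      by (rule C.poly_eval_pull_poly) (simp only: lifts fin | simp add: \<beta>)+
    also have "\<dots> = entry (poly_eval R \<rho> f) (i, j)"
      using w cl unfolding poly_eval_def
      by (auto simp: entry_finsum entry_smult intro!: C.finsum_cong')
    finally show ?thesis .
  qed
  have closedR: "poly_eval R \<rho> f \<in> carrier R"
    if \<rho>: "\<And>v. fst v \<in> carrier Q \<Longrightarrow> \<rho> v \<in> component (D (fst v))" for \<rho>
    unfolding poly_eval_def using f' \<rho>
    by (auto simp: component_def intro!: R.finsum_closed R.smult_closed word_eval_closed mult_closed)
  show ?thesis
  proof
    assume id: "f \<in> graded_identities Q R \<Gamma>"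
    show "\<forall>i<n. \<forall>j<n. \<forall>\<beta>. (\<forall>x. \<beta> x \<in> carrier C) \<longrightarrow> poly_eval C \<beta> (?F i j) = \<zero>\<^bsub>C\<^esub>"
    proof (intro allI impI)
      fix i j and \<beta> :: "('q \<times> nat) \<times> nat \<times> nat \<Rightarrow> 'c" assume ij: "i < n" "j < n" and \<beta>: "\<forall>x. \<beta> x \<in> carrier C"
      \<comment> \<open>\<open>entry_surj\<close> realises \<beta> as the entries of one matrix per
        variable; the zeros off \<open>D (fst v)\<close> make it homogeneous.\<close>
      have "\<exists>x\<in>carrier R. \<forall>p\<in>T. entry x p = (if p \<in> D (fst v) then \<beta> (v, p) else \<zero>\<^bsub>C\<^esub>)" for v
        using \<beta> by (intro entry_surj) (simp del: split_paired_All)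
      then obtain \<rho> where \<rho>: "\<And>v. \<rho> v \<in> carrier R"
        "\<And>v p. p \<in> T \<Longrightarrow> entry (\<rho> v) p = (if p \<in> D (fst v) then \<beta> (v, p) else \<zero>\<^bsub>C\<^esub>)"
        by metis
      have \<rho>': "\<rho> v \<in> component (D (fst v))" for v
        unfolding component_def mem_Collect_eq by (metis \<rho> entry_outside)
      have "poly_eval C \<beta> (?F i j) = entry (poly_eval R \<rho> f) (i, j)"
        using D by (intro evF ij \<rho>') (auto simp: \<beta> subset_iff \<rho>(2))
      also have "poly_eval R \<rho> f = \<zero>\<^bsub>R\<^esub>"
        using id \<rho>' unfolding graded_identities_def comp mem_Collect_eq by blast
      finally show "poly_eval C \<beta> (?F i j) = \<zero>\<^bsub>C\<^esub>" by (simp only: entry_zero)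
    qed
  next
    assume van: "\<forall>i<n. \<forall>j<n. \<forall>\<beta>. (\<forall>x. \<beta> x \<in> carrier C) \<longrightarrow> poly_eval C \<beta> (?F i j) = \<zero>\<^bsub>C\<^esub>"
    have "poly_eval R \<rho> f = \<zero>\<^bsub>R\<^esub>"
      if \<rho>: "\<And>v. fst v \<in> carrier Q \<Longrightarrow> \<rho> v \<in> component (D (fst v))" for \<rho>
    proof (rule entry_inj[OF closedR[OF \<rho>] R.zero_closed])
      fix p assume "p \<in> T"
      then obtain i j where p: "p = (i, j)" "i < n" "j < n" using T_subset by blast
      \<comment> \<open>A variable whose degree is not in Q is unconstrained under \<rho>, so its
        entries need not lie in C; the default zero keeps \<beta> inside C.\<close>
      define \<beta> where "\<beta> = (\<lambda>(v, p). if fst v \<in> carrier Q then entry (\<rho> v) p else \<zero>\<^bsub>C\<^esub>)"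
      have \<beta>: "\<beta> x \<in> carrier C" for x
        using \<rho> by (auto simp: \<beta>_def component_def entry_closed split: prod.split)
      have "entry (poly_eval R \<rho> f) p = poly_eval C \<beta> (?F i j)"
        unfolding p(1) by (rule evF[symmetric, OF \<rho> p(2,3) \<beta>]) (auto simp: \<beta>_def)
      then show "entry (poly_eval R \<rho> f) p = entry \<zero>\<^bsub>R\<^esub> p"
        using van p \<beta> by (simp add: entry_zero)
    qed auto
    then show "f \<in> graded_identities Q R \<Gamma>"
      using f by (auto simp: graded_identities_def comp)
  qed
qed

end

text \<open>The entry polynomials are built from f, n and D alone, so they coincide for the two
  algebras; their variables are not naturals, which is where \<open>identity_transfer\<close>
  enters. The statement is one-sided so that both inclusions of the theorem follow by exchanging the
  roles.\<close>

lemma graded_identities_matrix_coordinates_le: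
  fixes Q :: "('q, 'm) monoid_scheme"
  assumes "matrix_coordinates R C n T entry" "matrix_coordinates R' C' n T' entry'"
    and "\<And>q. q \<in> carrier Q \<Longrightarrow> D q \<subseteq> T" "\<And>q. q \<in> carrier Q \<Longrightarrow> D q \<subseteq> T'"
    and "\<And>q. q \<in> carrier Q \<Longrightarrow> \<Gamma> q = matrix_coordinates.component R C entry (D q)"
    and "\<And>q. q \<in> carrier Q \<Longrightarrow> \<Gamma>' q = matrix_coordinates.component R' C' entry' (D q)"
    and "ordinary_identities C \<subseteq> ordinary_identities C'"
  shows "graded_identities Q R \<Gamma> \<subseteq> graded_identities Q R' \<Gamma>'"
proof
  interpret R: matrix_coordinates R C n T entry by fact
  interpret R': matrix_coordinates R' C' n T' entry' by fact
  fix f assume f: "f \<in> graded_identities Q R \<Gamma>"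
  then have free: "f \<in> free_assoc (carrier Q \<times> UNIV)" by (auto simp: graded_identities_def)
  let ?U = "\<lambda>i j. {u. u \<noteq> [] \<and> index_path (D \<circ> fst) i j u}"
  have lifts: "{u \<in> ?U i j. map fst u \<in> Poly_Mapping.keys f}
      = (\<Union>w\<in>Poly_Mapping.keys f. path_lifts (D \<circ> fst) i j w)" for i j
    by (auto simp: path_lifts_def)
  have fin: "finite {u \<in> ?U i j. map fst u \<in> Poly_Mapping.keys f}" for i j
    unfolding lifts using free assms(3) R.T_subset
    by (intro finite_UN_I finite_keys finite_path_lifts[of _ _ n]) (fastforce simp: free_assoc_def)+
  have "pull_poly (map fst) (?U i j) f \<in> free_assoc UNIV" for i j
    by (auto simp: free_assoc_def keys_pull_poly[OF fin])
  then have "poly_eval C' \<beta> (pull_poly (map fst) (?U i j) f) = \<zero>\<^bsub>C'\<^esub>"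
    if "i < n" "j < n" "\<And>x. \<beta> x \<in> carrier C'" for i j \<beta>
    using that f R.graded_identities_iff[OF assms(3,5) free]
    by (intro identity_transfer[OF R.C.assoc_algebra_axioms R'.C.assoc_algebra_axioms assms(7)]) auto
  then show "f \<in> graded_identities Q R' \<Gamma>'"
    using R'.graded_identities_iff[OF assms(4,6) free] by auto
qed

section \<open>Subspaces and components\<close>

context Module.module
begin

lemma finsum_in_submodule:
  assumes "LinearCombinations.submodule R N M" "finite S" "f \<in> S \<rightarrow> N"
  shows "(\<Oplus>\<^bsub>M\<^esub>s\<in>S. f s) \<in> N"
proof -
  interpret N: LinearCombinations.submodule R N M by fact
  have "N \<subseteq> carrier M" by (rule N.subset)
  show ?thesis
    using assms(2,3)
  proof (induction S rule: finite_induct)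
    case (insert s S)
    then have "f s \<in> carrier M" "f \<in> S \<rightarrow> carrier M"
      using \<open>N \<subseteq> carrier M\<close> by auto
    then show ?case using insert by simp
  qed simp
qed

end

context matrix_coordinates
begin

lemma submodule_component: "LinearCombinations.submodule class_ring (component D) R"
proof (rule LinearCombinations.submodule.intro)
  show "Module.module class_ring R" by (rule R.module_axioms)
qed (auto simp: component_def entry_add entry_smult entry_zero)

lemma span_eq_componentI:
  assumes "S \<subseteq> component D" "\<And>x. x \<in> component D \<Longrightarrow> x \<in> lin_span R S"
  shows "lin_span R S = component D"
  using R.span_is_subset[OF assms(1) submodule_component] assms(2) by blast

end

section \<open>Upper block triangular matrices\<close>

text \<open>
  An entry lies on or above the block diagonal iff no block boundary separates its column from a
  larger row. This form makes transitivity immediate and scales well with the block sizes.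
\<close>

definition upper_pairs :: "nat list \<Rightarrow> (nat \<times> nat) set" where
  "upper_pairs d = {(i, j). i < sum_list d \<and> j < sum_list d \<and>
    (\<forall>p. sum_list (take p d) \<le> i \<longrightarrow> sum_list (take p d) \<le> j)}"

lemma upper_pairs_less:
  assumes "(i, j) \<in> upper_pairs d"
  shows "i < sum_list d" "j < sum_list d"
  using assms by (auto simp: upper_pairs_def)

lemma upper_pairs_square: "p \<in> upper_pairs d \<Longrightarrow> p \<in> {..<sum_list d} \<times> {..<sum_list d}"
  by (auto simp: upper_pairs_def)

lemma finite_upper_pairs: "finite (upper_pairs d)"
  by (rule finite_subset[of _ "{..<sum_list d} \<times> {..<sum_list d}"]) (auto simp: upper_pairs_def)

lemma upper_pairs_trans:
  "(i, j) \<in> upper_pairs d \<Longrightarrow> (j, k) \<in> upper_pairs d \<Longrightarrow> (i, k) \<in> upper_pairs d"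
  by (auto simp: upper_pairs_def)

lemma sum_list_take_mono:
  fixes d :: "nat list"
  shows "p \<le> q \<Longrightarrow> sum_list (take p d) \<le> sum_list (take q d)"
  by (metis le_add1 le_add_diff_inverse sum_list_append take_add)

lemma ex_block:
  fixes d :: "nat list"
  assumes "i < sum_list d"
  shows "\<exists>p r. p < length d \<and> r < d ! p \<and> i = sum_list (take p d) + r"
  using assms
proof (induction d arbitrary: i)
  case (Cons k d)
  show ?case
  proof (cases "i < k")
    case True
    then show ?thesis by (intro exI[of _ 0] exI[of _ i]) simp
  next
    case False
    then have "i - k < sum_list d" using Cons.prems by simp
    then obtain p r where "p < length d" "r < d ! p" "i - k = sum_list (take p d) + r"
      using Cons.IH by blast
    then show ?thesis using False by (intro exI[of _ "Suc p"] exI[of _ r]) simp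
  qed
qed simp

text \<open>With i in block p and j in block q, the position is below the block diagonal (q < p)
  exactly when some boundary o' satisfies q < o' \<le> p, that is, j lies before the boundary and i
  does not.\<close>

lemma carrier_UT:
  "carrier (UT d) = {M \<in> carrier_mat (sum_list d) (sum_list d).
    \<forall>i<sum_list d. \<forall>j<sum_list d. (i, j) \<notin> upper_pairs d \<longrightarrow> M $$ (i, j) = 0}"
proof -
  have block: "sum_list (take p d) + r < sum_list (take (Suc p) d)"
    "sum_list (take (Suc p) d) \<le> sum_list d" if "p < length d" "r < d ! p" for p r
    using that sum_list_take_mono[of "Suc p" "length d" d]
    by (auto simp: take_Suc_conv_app_nth)
  have "(\<forall>p < length d. \<forall>q < p. \<forall>r < d ! p. \<forall>s < d ! q.
        M $$ (sum_list (take p d) + r, sum_list (take q d) + s) = 0) \<longleftrightarrow>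
      (\<forall>i<sum_list d. \<forall>j<sum_list d. (i, j) \<notin> upper_pairs d \<longrightarrow> M $$ (i, j) = 0)"
    (is "?L \<longleftrightarrow> ?R") for M :: "'a mat"
  proof
    assume L: ?L
    show ?R
    proof (intro allI impI)
      fix i j assume ij: "i < sum_list d" "j < sum_list d" "(i, j) \<notin> upper_pairs d"
      then obtain o' where o': "sum_list (take o' d) \<le> i" "j < sum_list (take o' d)"
        by (auto simp: upper_pairs_def not_le)
      obtain p r where p: "p < length d" "r < d ! p" "i = sum_list (take p d) + r"
        using ex_block[OF ij(1)] by blast
      obtain q s where q: "q < length d" "s < d ! q" "j = sum_list (take q d) + s"
        using ex_block[OF ij(2)] by blast
      have "o' \<le> p"
        using sum_list_take_mono[of "Suc p" o' d] block[OF p(1,2)] p(3) o'(1) by (cases "o' \<le> p") auto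
      moreover have "q < o'"
        using sum_list_take_mono[of o' q d] q(3) o'(2) by (cases "q < o'") auto
      ultimately show "M $$ (i, j) = 0" using L p q by auto
    qed
  next
    assume R: ?R
    show ?L
    proof (intro allI impI)
      fix p q r s assume *: "p < length d" "q < p" "r < d ! p" "s < d ! q"
      then have "sum_list (take q d) + s < sum_list (take p d)"
        using block(1)[of q s] sum_list_take_mono[of "Suc q" p d] by simp
      moreover have "sum_list (take p d) + r < sum_list d"
        using block[of p r] * by simp
      \<comment> \<open>Boundary p separates the two indices: the row is at or beyond it, the column
        before it.\<close>
      moreover have "\<not> sum_list (take p d) \<le> sum_list (take q d) + s"
        using calculation(1) by simp
      then have "(sum_list (take p d) + r, sum_list (take q d) + s) \<notin> upper_pairs d"
        unfolding upper_pairs_def using le_add1 by blast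
      ultimately show "M $$ (sum_list (take p d) + r, sum_list (take q d) + s) = 0"
        using R by simp
    qed
  qed
  then show ?thesis by (simp add: UT_def)
qed

section \<open>Algebra structure and matrix units of UT(d)\<close>

lemma UT_simps:
  "mult (UT d) = (*)" "add (UT d) = (+)" "zero (UT d) = 0\<^sub>m (sum_list d) (sum_list d)"
  "smult (UT d) = (\<cdot>\<^sub>m)"
  by (simp_all add: UT_def module_mat_def)

lemma UT_mat: "M \<in> carrier (UT d) \<Longrightarrow> M \<in> carrier_mat (sum_list d) (sum_list d)"
  by (simp add: carrier_UT)

lemma UT_zero:
  "M \<in> carrier (UT d) \<Longrightarrow> i < sum_list d \<Longrightarrow> j < sum_list d \<Longrightarrow> (i, j) \<notin> upper_pairs d
    \<Longrightarrow> M $$ (i, j) = 0"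
  by (simp add: carrier_UT)

lemma index_mult_UT:
  assumes "M \<in> carrier (UT d)" "N \<in> carrier (UT d)" "i < sum_list d" "j < sum_list d"
  shows "(M * N) $$ (i, j) = (\<Sum>k<sum_list d. M $$ (i, k) * N $$ (k, j))"
  using assms UT_mat[OF assms(1)] UT_mat[OF assms(2)]
  by (auto simp: scalar_prod_def lessThan_atLeast0 intro!: sum.cong)

lemma mult_UT:
  assumes "M \<in> carrier (UT d)" "N \<in> carrier (UT d)"
  shows "M * N \<in> carrier (UT d)"
proof -
  have "(M * N) $$ (i, j) = 0"
    if "i < sum_list d" "j < sum_list d" "(i, j) \<notin> upper_pairs d" for i j
  proof -
    \<comment> \<open>By transitivity of the pattern, (i, k) and (k, j) cannot both lie in
      it.\<close>
    have "M $$ (i, k) * N $$ (k, j) = 0" if "k < sum_list d" for k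
      using UT_zero[OF assms(1), of i k] UT_zero[OF assms(2), of k j] that \<open>i < sum_list d\<close>
        \<open>j < sum_list d\<close> \<open>(i, j) \<notin> upper_pairs d\<close> upper_pairs_trans[of i k d j] by auto
    then show ?thesis using that assms by (simp only: index_mult_UT) (auto intro: sum.neutral)
  qed
  then show ?thesis using UT_mat[OF assms(1)] UT_mat[OF assms(2)] unfolding carrier_UT by auto
qed

lemma assoc_algebra_UT: "assoc_algebra (UT d :: ('k :: field, 'k mat) module)"
proof -
  let ?n = "sum_list d"
  interpret V: vectorspace class_ring "module_mat TYPE('k) ?n ?n" by (rule matrix_vs)
  have "LinearCombinations.submodule class_ring (carrier (UT d)) (module_mat TYPE('k) ?n ?n)"
    by (rule LinearCombinations.submodule.intro, rule V.module_axioms)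
      (auto simp: carrier_UT module_mat_def)
  then have "Module.module class_ring (module_mat TYPE('k) ?n ?n\<lparr>carrier := carrier (UT d)\<rparr>)"
    by (rule V.submodule_is_module)
  moreover have "module_mat TYPE('k) ?n ?n\<lparr>carrier := carrier (UT d)\<rparr> = UT d"
    by (simp add: UT_def)
  ultimately interpret U: Module.module class_ring "UT d :: ('k, 'k mat) module" by simp
  show ?thesis
    apply unfold_locales
    unfolding UT_simps
    apply (rule mult_UT; assumption)
    subgoal using assoc_mult_mat UT_mat by blast
    subgoal using add_mult_distrib_mat UT_mat by blast
    subgoal using mult_add_distrib_mat UT_mat by blast
    subgoal using mult_smult_assoc_mat UT_mat by blast
    subgoal using mult_smult_distrib UT_mat by blast
    done
qed

lemma index_finsum_UT:
  fixes f :: "'s \<Rightarrow> 'k :: field mat"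
  assumes "finite S" "f \<in> S \<rightarrow> carrier (UT d)" "i < sum_list d" "j < sum_list d"
  shows "(\<Oplus>\<^bsub>UT d\<^esub>s\<in>S. f s) $$ (i, j) = (\<Sum>s\<in>S. f s $$ (i, j))"
proof -
  interpret U: assoc_algebra "UT d :: ('k, 'k mat) module" by (rule assoc_algebra_UT)
  show ?thesis
    using assms
  proof (induction S rule: finite_induct)
    case (insert s S)
    then have f: "f s \<in> carrier (UT d)" "f \<in> S \<rightarrow> carrier (UT d)" by auto
    then have "(\<Oplus>\<^bsub>UT d\<^esub>s\<in>S. f s) \<in> carrier_mat (sum_list d) (sum_list d)"
      by (intro UT_mat U.finsum_closed)
    then show ?case using insert f UT_mat[OF f(1)] by (simp add: UT_simps)
  qed (simp add: UT_simps)
qed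

lemma unit_mat_UT: 
  assumes "i < sum_list d" "j < sum_list d"
  shows "(unit_mat (sum_list d) i j :: 'k :: field mat) \<in> carrier (UT d) \<longleftrightarrow> (i, j) \<in> upper_pairs d"
  using assms by (auto simp: carrier_UT unit_mat_def)

text \<open>Two choices of P matter: the full pattern expands an arbitrary matrix in the tensor
  product, a smaller P expands a homogeneous matrix within its component.\<close>

lemma UT_sum_unit_mat:
  fixes M :: "'k :: field mat"
  assumes "M \<in> carrier (UT d)" "P \<subseteq> upper_pairs d"
    and "\<And>p. p \<in> upper_pairs d \<Longrightarrow> p \<notin> P \<Longrightarrow> M $$ p = 0"
  shows "M = (\<Oplus>\<^bsub>UT d\<^esub>p\<in>P. M $$ p \<odot>\<^bsub>UT d\<^esub> unit_mat (sum_list d) (fst p) (snd p))"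
    (is "M = ?S")
proof -
  interpret U: assoc_algebra "UT d :: ('k, 'k mat) module" by (rule assoc_algebra_UT)
  let ?n = "sum_list d"
  have fin: "finite P"
    by (rule finite_subset[OF assms(2) finite_upper_pairs])
  have unit: "unit_mat ?n (fst p) (snd p) \<in> carrier (UT d)" if "p \<in> P" for p
    using that assms(2) by (subst unit_mat_UT) (auto simp: upper_pairs_def)
  have cl: "M $$ p \<odot>\<^bsub>UT d\<^esub> unit_mat ?n (fst p) (snd p) \<in> carrier (UT d)" if "p \<in> P" for p
    using unit[OF that] by (intro U.smult_closed) auto
  have S: "?S \<in> carrier (UT d)" using cl by (intro U.finsum_closed) auto
  show ?thesis
  proof (rule eq_matI)
    fix i j assume "i < dim_row ?S" "j < dim_col ?S"
    then have ij: "i < ?n" "j < ?n" using UT_mat[OF S] by auto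
    have "?S $$ (i, j) = (\<Sum>p\<in>P. (M $$ p \<odot>\<^bsub>UT d\<^esub> unit_mat ?n (fst p) (snd p)) $$ (i, j))"
      using cl ij by (intro index_finsum_UT fin) auto
    also have "\<dots> = (\<Sum>p\<in>P. if p = (i, j) then M $$ p else 0)"
      using ij by (intro sum.cong) (auto simp: UT_simps unit_mat_def)
    also have "\<dots> = M $$ (i, j)"
      using assms(3)[of "(i, j)"] UT_zero[OF assms(1) ij] by (auto simp: sum.delta[OF fin])
    finally show "M $$ (i, j) = ?S $$ (i, j)" ..
  qed (use UT_mat[OF S] UT_mat[OF assms(1)] in auto)
qed

section \<open>Subdividing UT(d_1 t, ..., d_m t) into blocks of size t\<close>

lemma UT_single: "UT [t] = (module_mat TYPE('k :: field) t t :: ('k, 'k mat) module)"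
  by (simp add: UT_def module_mat_def)

lemma assoc_algebra_mat: "assoc_algebra (module_mat TYPE('k :: field) t t)"
  using assoc_algebra_UT[of "[t]"] by (simp add: UT_single)

text \<open>All block boundaries of the scaled list are multiples of t, so none falls strictly
  inside a run of t indices, and the pattern does not see the offsets r and s.\<close>

lemma upper_pairs_scale:
  assumes "r < t" "s < t"
  shows "(i * t + r, j * t + s) \<in> upper_pairs (map (\<lambda>k. k * t) d) \<longleftrightarrow> (i, j) \<in> upper_pairs d"
proof -
  have less: "a * t + u < b * t \<longleftrightarrow> a < b" if "u < t" for a b u :: nat
  proof
    show "a < b" if "a * t + u < b * t"
      using that by (metis add_lessD1 mult_less_cancel2)
    assume "a < b"
    then have "Suc a * t \<le> b * t" by (intro mult_right_mono) auto
    then show "a * t + u < b * t" using \<open>u < t\<close> by simp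
  qed
  have le: "b * t \<le> a * t + u \<longleftrightarrow> b \<le> a" if "u < t" for a b u :: nat
    using less[OF that] by (simp flip: not_less)
  show ?thesis
    using assms by (simp add: upper_pairs_def take_map sum_list_mult_const less le)
qed

lemma nth_concat_replicate:
  assumes "i < length xs" "r < t"
  shows "concat (map (\<lambda>x. replicate t (f x)) xs) ! (i * t + r) = f (xs ! i)"
  using assms
proof (induction xs arbitrary: i)
  case (Cons x xs)
  then show ?case
  proof (cases i)
    case (Suc i')
    then show ?thesis using Cons by (simp add: nth_append)
  qed (simp add: nth_append)
qed simp

text \<open>The guard fixes the value at every p, including positions beyond the square, where M has
  no entries. Inside the square it changes nothing for M in the scaled UT, which vanishes off the
  pattern.\<close>

definition block_entry :: "nat list \<Rightarrow> nat \<Rightarrow> 'k :: field mat \<Rightarrow> nat \<times> nat \<Rightarrow> 'k mat" where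
  "block_entry d t M p = mat t t (\<lambda>(r, s).
    if p \<in> upper_pairs d then M $$ (fst p * t + r, snd p * t + s) else 0)"

lemma sum_list_scale: "sum_list (map (\<lambda>k. k * t) d) = sum_list d * (t :: nat)"
  by (simp add: sum_list_mult_const)

lemma block_index_less:
  assumes "i < n" "r < (t :: nat)"
  shows "i * t + r < n * t"
proof -
  have "Suc i * t \<le> n * t" using assms(1) by (intro mult_right_mono) auto
  then show ?thesis using assms(2) by simp
qed

lemma block_entry_index:
  assumes "M \<in> carrier (UT (map (\<lambda>k. k * t) d))" "r < t" "s < t" "i < sum_list d" "j < sum_list d"
  shows "block_entry d t M (i, j) $$ (r, s) = M $$ (i * t + r, j * t + s)"
proof (cases "(i, j) \<in> upper_pairs d")
  case False
  then have "M $$ (i * t + r, j * t + s) = 0"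
    using assms
    by (intro UT_zero[OF assms(1)]) (simp_all add: sum_list_scale block_index_less upper_pairs_scale)
  then show ?thesis using False assms by (simp add: block_entry_def)
qed (use assms in \<open>simp add: block_entry_def\<close>)

text \<open>An index a of the large matrix is read as \<open>a div t\<close> (which block) and
  \<open>a mod t\<close> (where in the block); products then become block multiplication.\<close>

lemma matrix_coordinates_UT:
  fixes t :: nat and d :: "nat list"
  assumes t: "0 < t"
  defines "d' \<equiv> map (\<lambda>k. k * t) d"
  shows "matrix_coordinates (UT d' :: ('k :: field, 'k mat) module) (module_mat TYPE('k) t t)
    (sum_list d) (upper_pairs d) (block_entry d t)"
proof -
  interpret R: assoc_algebra "UT d' :: ('k, 'k mat) module" by (rule assoc_algebra_UT)
  interpret C: assoc_algebra "module_mat TYPE('k) t t" by (rule assoc_algebra_mat)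
  let ?n = "sum_list d"
  have n': "sum_list d' = ?n * t" by (simp add: d'_def sum_list_scale)
  have R_mat: "M \<in> carrier_mat (?n * t) (?n * t)" if "M \<in> carrier (UT d')" for M :: "'k mat"
    using UT_mat[OF that] by (simp add: n')
  have inside: "i * t + r < ?n * t" "j * t + s < ?n * t"
    if "(i, j) \<in> upper_pairs d" "r < t" "s < t" for i j r s
    using upper_pairs_less[OF that(1)] that(2,3) by (simp_all add: block_index_less)
  have scale: "(a, b) \<in> upper_pairs d' \<longleftrightarrow> (a div t, b div t) \<in> upper_pairs d" for a b
    using upper_pairs_scale[of "a mod t" t "b mod t" "a div t" "b div t" d] t by (simp add: d'_def)
  show ?thesis
  proof unfold_locales
    show "upper_pairs d \<subseteq> {..<?n} \<times> {..<?n}" using upper_pairs_less by auto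
  next
    fix x y :: "'k mat" assume x: "x \<in> carrier (UT d')" and y: "y \<in> carrier (UT d')"
    show "x \<otimes>\<^bsub>UT d'\<^esub> y \<in> carrier (UT d')" using x y by (rule R.mult_closed)
    show "block_entry d t (x \<oplus>\<^bsub>UT d'\<^esub> y) p
        = block_entry d t x p \<oplus>\<^bsub>module_mat TYPE('k) t t\<^esub> block_entry d t y p" for p
      using R_mat[OF x] R_mat[OF y] inside[of "fst p" "snd p"]
      by (intro eq_matI) (auto simp: UT_simps module_mat_simps block_entry_def)
    show "block_entry d t (x \<otimes>\<^bsub>UT d'\<^esub> y) (i, j) = (\<Oplus>\<^bsub>module_mat TYPE('k) t t\<^esub>k\<in>{..<?n}.
        block_entry d t x (i, k) \<otimes>\<^bsub>module_mat TYPE('k) t t\<^esub> block_entry d t y (k, j))" (is "?L = ?S")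
      if ij: "i < ?n" "j < ?n" for i j
    proof -
      have cl: "(\<lambda>k. block_entry d t x (i, k) \<otimes>\<^bsub>module_mat TYPE('k) t t\<^esub> block_entry d t y (k, j))
          \<in> {..<?n} \<rightarrow> carrier (module_mat TYPE('k) t t)"
        by (auto simp: module_mat_simps block_entry_def)
      then have S: "?S \<in> carrier_mat t t"
        using C.finsum_closed by (simp add: module_mat_simps)
      show ?thesis
      proof (rule eq_matI)
        fix r s assume "r < dim_row ?S" "s < dim_col ?S"
        then have rs: "r < t" "s < t" using S by auto
        have "?L $$ (r, s) = (x * y) $$ (i * t + r, j * t + s)"
          using x y ij rs R.mult_closed[OF x y] by (simp add: block_entry_index d'_def UT_simps)
        also have "\<dots> = (\<Sum>l<?n * t. x $$ (i * t + r, l) * y $$ (l, j * t + s))"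
          using ij rs by (subst index_mult_UT[OF x y]) (simp_all add: n' block_index_less)
        \<comment> \<open>Block multiplication: the inner index is cut into runs of length t, one
          for each middle block k.\<close>
        also have "\<dots> = (\<Sum>k<?n. \<Sum>l=k * t..<k * t + t. x $$ (i * t + r, l) * y $$ (l, j * t + s))"
          by (rule sum.nat_group[symmetric])
        also have "\<dots> = (\<Sum>k<?n. (block_entry d t x (i, k) * block_entry d t y (k, j)) $$ (r, s))"
        proof (intro sum.cong refl)
          fix k assume "k \<in> {..<?n}"
          then have k: "k < ?n" by simp
          have dim: "block_entry d t x p \<in> carrier_mat t t" "block_entry d t y p \<in> carrier_mat t t" for p
            by (simp_all add: block_entry_def)
          have "(\<Sum>l=k * t..<k * t + t. x $$ (i * t + r, l) * y $$ (l, j * t + s))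
              = (\<Sum>u=0..<t. x $$ (i * t + r, k * t + u) * y $$ (k * t + u, j * t + s))"
            using sum.shift_bounds_nat_ivl[of "\<lambda>l. x $$ (i * t + r, l) * y $$ (l, j * t + s)" 0 "k * t" t]
            by (simp add: add.commute)
          also have "\<dots> = (\<Sum>u=0..<t. block_entry d t x (i, k) $$ (r, u) * block_entry d t y (k, j) $$ (u, s))"
            using x y ij rs k by (intro sum.cong) (simp_all add: block_entry_index d'_def)
          also have "\<dots> = (block_entry d t x (i, k) * block_entry d t y (k, j)) $$ (r, s)"
            using rs dim[of "(i, k)"] dim[of "(k, j)"] by (simp add: scalar_prod_def)
          finally show "(\<Sum>l=k * t..<k * t + t. x $$ (i * t + r, l) * y $$ (l, j * t + s))
            = (block_entry d t x (i, k) * block_entry d t y (k, j)) $$ (r, s)" .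
        qed
        \<comment> \<open>M_t is \<open>UT [t]\<close>, so the entrywise formula for sums in UT
          applies to the coefficient algebra.\<close>
        also have "\<dots> = ?S $$ (r, s)"
          using index_finsum_UT[of "{..<?n}" _ "[t]" r s, symmetric] cl rs
          by (simp add: UT_single module_mat_simps)
        finally show "?L $$ (r, s) = ?S $$ (r, s)" .
      qed (use S in \<open>auto simp: block_entry_def\<close>)
    qed
    show "x = y" if eq: "\<And>p. p \<in> upper_pairs d \<Longrightarrow> block_entry d t x p = block_entry d t y p"
    proof (rule eq_matI)
      fix a b assume "a < dim_row y" "b < dim_col y"
      then have ab: "a < ?n * t" "b < ?n * t" using R_mat[OF y] by auto
      show "x $$ (a, b) = y $$ (a, b)"
      proof (cases "(a, b) \<in> upper_pairs d'")
        case True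
        then have "(a div t, b div t) \<in> upper_pairs d" by (simp add: scale)
        then have "block_entry d t x (a div t, b div t) $$ (a mod t, b mod t)
            = block_entry d t y (a div t, b div t) $$ (a mod t, b mod t)"
          using eq by simp
        then show ?thesis
          using \<open>(a div t, b div t) \<in> upper_pairs d\<close> t by (simp add: block_entry_def)
      next
        case False
        then show ?thesis using UT_zero[OF x] UT_zero[OF y] ab by (simp add: n')
      qed
    qed (use R_mat[OF x] R_mat[OF y] in auto)
  next
    fix x :: "'k mat" and p assume x: "x \<in> carrier (UT d')"
    show "block_entry d t x p \<in> carrier (module_mat TYPE('k) t t)"
      by (simp add: block_entry_def module_mat_simps)
    show "block_entry d t x p = \<zero>\<^bsub>module_mat TYPE('k) t t\<^esub>" if "p \<notin> upper_pairs d"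
      using that by (intro eq_matI) (auto simp: block_entry_def module_mat_simps)
    show "block_entry d t (c \<odot>\<^bsub>UT d'\<^esub> x) p = c \<odot>\<^bsub>module_mat TYPE('k) t t\<^esub> block_entry d t x p" for c
      using R_mat[OF x] inside[of "fst p" "snd p"]
      by (intro eq_matI) (auto simp: UT_simps module_mat_simps block_entry_def)
  next
    fix b :: "nat \<times> nat \<Rightarrow> 'k mat"
    assume b: "\<And>p. p \<in> upper_pairs d \<Longrightarrow> b p \<in> carrier (module_mat TYPE('k) t t)"
    \<comment> \<open>The given blocks are glued: the quotients by t select the block, the
      remainders the place in it.\<close>
    define M where "M = mat (?n * t) (?n * t) (\<lambda>(u, v).
      if (u div t, v div t) \<in> upper_pairs d then b (u div t, v div t) $$ (u mod t, v mod t) else 0)"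
    have "M \<in> carrier (UT d')"
      by (simp add: carrier_UT n' M_def scale)
    moreover have "block_entry d t M p = b p" if "p \<in> upper_pairs d" for p
      using b[OF that] that inside[of "fst p" "snd p"] t
      by (intro eq_matI) (auto simp: block_entry_def M_def module_mat_simps)
    ultimately show "\<exists>x\<in>carrier (UT d'). \<forall>p\<in>upper_pairs d. block_entry d t x p = b p"
      by blast
  qed
qed

text \<open>As \<open>gs\<close> is constant on runs of t indices, the degree of a matrix unit at
  (a, b) depends only on its block (a div t, b div t), and so does membership in the pattern. A
  component therefore consists of complete blocks.\<close>

lemma elementary_grading_UT:
  fixes t :: nat and d :: "nat list" and h :: "nat \<Rightarrow> 'q"
  assumes t: "0 < t"
    and gs: "\<And>i r. i < sum_list d \<Longrightarrow> r < t \<Longrightarrow> gs ! (i * t + r) = h i"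
  defines "d' \<equiv> map (\<lambda>k. k * t) d"
  shows "(elementary_grading Q d' gs q :: 'k :: field mat set)
    = matrix_coordinates.component (UT d') (module_mat TYPE('k) t t) (block_entry d t)
        {(i, j) \<in> upper_pairs d. h i \<otimes>\<^bsub>Q\<^esub> inv\<^bsub>Q\<^esub> (h j) = q}"
    (is "_ = matrix_coordinates.component _ _ _ ?D")
proof -
  interpret U: assoc_algebra "UT d' :: ('k, 'k mat) module" by (rule assoc_algebra_UT)
  interpret M: matrix_coordinates "UT d' :: ('k, 'k mat) module" "module_mat TYPE('k) t t"
    "sum_list d" "upper_pairs d" "block_entry d t"
    unfolding d'_def by (rule matrix_coordinates_UT[OF t])
  let ?n' = "sum_list d'"
  have n': "?n' = sum_list d * t" by (simp add: d'_def sum_list_scale)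
  have scale: "(a, b) \<in> upper_pairs d' \<longleftrightarrow> (a div t, b div t) \<in> upper_pairs d" for a b
    using upper_pairs_scale[of "a mod t" t "b mod t" "a div t" "b div t" d] t by (simp add: d'_def)
  have div: "a div t < sum_list d" if "a < ?n'" for a
    using that n' t by (simp add: div_less_iff_less_mult)
  have gs': "gs ! a = h (a div t)" if "a < ?n'" for a
    using gs[OF div[OF that], of "a mod t"] t by simp
  let ?S = "{unit_mat ?n' a b :: 'k mat | a b. a < ?n' \<and> b < ?n' \<and>
      (unit_mat ?n' a b :: 'k mat) \<in> carrier (UT d') \<and> gs ! a \<otimes>\<^bsub>Q\<^esub> inv\<^bsub>Q\<^esub> (gs ! b) = q}"
  have S: "?S = {unit_mat ?n' a b | a b. (a, b) \<in> upper_pairs d' \<and> (a div t, b div t) \<in> ?D}"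
  proof -
    have "a < ?n' \<and> b < ?n' \<and> (unit_mat ?n' a b :: 'k mat) \<in> carrier (UT d') \<and>
        gs ! a \<otimes>\<^bsub>Q\<^esub> inv\<^bsub>Q\<^esub> (gs ! b) = q
      \<longleftrightarrow> (a, b) \<in> upper_pairs d' \<and> (a div t, b div t) \<in> ?D" for a b
      using scale[of a b] unit_mat_UT[of a d' b, where 'k = 'k] gs'[of a] gs'[of b]
        upper_pairs_less[of a b d'] by auto
    then show ?thesis by simp
  qed
  have "lin_span (UT d') ?S = M.component ?D"
  proof (rule M.span_eq_componentI)
    show "?S \<subseteq> M.component ?D"
    proof
      fix x :: "'k mat" assume "x \<in> ?S"
      then obtain a b where ab: "x = unit_mat ?n' a b" "a < ?n'" "b < ?n'" "x \<in> carrier (UT d')"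
        "(a div t, b div t) \<in> ?D"
        unfolding S by (auto simp: unit_mat_UT upper_pairs_def)
      have "block_entry d t x p = \<zero>\<^bsub>module_mat TYPE('k) t t\<^esub>" if "p \<notin> ?D" for p
        using that ab t
        by (intro eq_matI) (auto simp: block_entry_def module_mat_simps unit_mat_def upper_pairs_def n' block_index_less
            split: if_splits)
      then show "x \<in> M.component ?D" using ab(4) by (simp add: M.component_def)
    qed
  next
    fix x :: "'k mat" assume x: "x \<in> M.component ?D"
    then have xU: "x \<in> carrier (UT d')" by (simp add: M.component_def)
    \<comment> \<open>These are the positions inside the blocks of \<open>?D\<close>; a matrix of
      the component vanishes at all others and is a combination of their matrix units.\<close>
    let ?P = "{(a, b). (a, b) \<in> upper_pairs d' \<and> (a div t, b div t) \<in> ?D}"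
    have "x $$ (a, b) = 0" if ab: "(a, b) \<in> upper_pairs d'" "(a, b) \<notin> ?P" for a b
    proof -
      have *: "(a div t, b div t) \<in> upper_pairs d" "(a div t, b div t) \<notin> ?D"
        using ab by (auto simp: scale)
      then have "block_entry d t x (a div t, b div t) $$ (a mod t, b mod t) = 0"
        using x t by (simp add: M.component_def module_mat_simps)
      then show ?thesis using *(1) t by (simp add: block_entry_def)
    qed
    then have "x = (\<Oplus>\<^bsub>UT d'\<^esub>p\<in>?P. x $$ p \<odot>\<^bsub>UT d'\<^esub> unit_mat ?n' (fst p) (snd p))"
      by (intro UT_sum_unit_mat[OF xU]) auto
    moreover have "\<dots> \<in> lin_span (UT d') ?S"
    proof (rule U.finsum_in_submodule)
      have sub: "?S \<subseteq> carrier (UT d')" by auto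
      show span: "LinearCombinations.submodule class_ring (lin_span (UT d') ?S) (UT d')"
        by (rule U.span_is_submodule[OF sub])
      show "finite ?P"
        by (rule finite_subset[OF _ finite_upper_pairs[of d']]) auto
      show "(\<lambda>p. x $$ p \<odot>\<^bsub>UT d'\<^esub> unit_mat ?n' (fst p) (snd p)) \<in> ?P \<rightarrow> lin_span (UT d') ?S"
      proof
        fix p assume "p \<in> ?P"
        then have "unit_mat ?n' (fst p) (snd p) \<in> ?S"
          unfolding S mem_Collect_eq by (intro exI[of _ "fst p"] exI[of _ "snd p"]) auto
        then have "unit_mat ?n' (fst p) (snd p) \<in> lin_span (UT d') ?S"
          using U.in_own_span[OF sub] by blast
        then show "x $$ p \<odot>\<^bsub>UT d'\<^esub> unit_mat ?n' (fst p) (snd p) \<in> lin_span (UT d') ?S"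
          by (intro LinearCombinations.submodule.smult_closed[OF span]) auto
      qed
    qed
    ultimately show "x \<in> lin_span (UT d') ?S" by simp
  qed
  then show ?thesis by (simp add: elementary_grading_def)
qed

section \<open>The tensor product with an upper block triangular matrix algebra\<close>

lemma (in abelian_monoid) finsum_swap:
  assumes "finite S" "finite U" "\<And>s u. s \<in> S \<Longrightarrow> u \<in> U \<Longrightarrow> f s u \<in> carrier G"
  shows "(\<Oplus>s\<in>S. \<Oplus>u\<in>U. f s u) = (\<Oplus>u\<in>U. \<Oplus>s\<in>S. f s u)"
  using assms(1,3)
proof (induction S rule: finite_induct)
  case (insert s S)
  have "(\<Oplus>s\<in>insert s S. \<Oplus>u\<in>U. f s u) = (\<Oplus>u\<in>U. f s u) \<oplus> (\<Oplus>u\<in>U. \<Oplus>s\<in>S. f s u)"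
    using insert by (simp add: Pi_iff finsum_closed)
  also have "\<dots> = (\<Oplus>u\<in>U. f s u \<oplus> (\<Oplus>s\<in>S. f s u))"
    using insert by (intro finsum_addf[symmetric]) (auto intro!: finsum_closed)
  also have "\<dots> = (\<Oplus>u\<in>U. \<Oplus>s\<in>insert s S. f s u)"
    using insert by (intro finsum_cong') (auto intro!: finsum_closed)
  finally show ?case .
qed simp

section \<open>The free space on pairs (a, b)\<close>

abbreviation scale_poly :: "'k :: field \<Rightarrow> ('a \<Rightarrow>\<^sub>0 'k) \<Rightarrow> ('a \<Rightarrow>\<^sub>0 'k)" where
  "scale_poly c \<equiv> Poly_Mapping.map ((*) c)"

lemma lookup_scale_poly: "Poly_Mapping.lookup (scale_poly c f) x = c * Poly_Mapping.lookup f x"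
  by (simp add: Poly_Mapping.map.rep_eq when_def)

lemma scale_poly_simps:
  "scale_poly c (f + g) = scale_poly c f + scale_poly c g"
  "scale_poly (a + c) f = scale_poly a f + scale_poly c f"
  "scale_poly (a * c) f = scale_poly a (scale_poly c f)"
  "scale_poly 1 f = f"
  "scale_poly (- 1) f = - f"
  by (auto intro!: poly_mapping_eqI simp: lookup_scale_poly lookup_add algebra_simps)

lemma poly_mapping_sum_single:
  "(\<Sum>x\<in>Poly_Mapping.keys f. Poly_Mapping.single x (Poly_Mapping.lookup f x)) = f"
  by (rule poly_mapping_eqI) (simp add: lookup_sum lookup_single when_def in_keys_iff)

locale tensor_UT = B: assoc_algebra B
  for B :: "('k :: field, 'b) module" +
  fixes d :: "nat list"
begin

abbreviation n :: nat where "n \<equiv> sum_list d"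
abbreviation A :: "('k, 'k mat) module" where "A \<equiv> UT d"
abbreviation F where "F \<equiv> tensor_free A B"
abbreviation I where "I \<equiv> tensor_ideal A B"

lemma F_simps:
  "carrier F = {f. Poly_Mapping.keys f \<subseteq> carrier A \<times> carrier B}"
  "zero F = 0" "add F = (+)" "smult F = scale_poly"
  by (simp_all add: tensor_free_def)

sublocale A: assoc_algebra A by (rule assoc_algebra_UT)

lemma single_F [simp]: "Poly_Mapping.single (a, b) c \<in> carrier F" if "a \<in> carrier A" "b \<in> carrier B"
  using that by (simp add: F_simps)

lemma add_F [simp]: "f + g \<in> carrier F" if "f \<in> carrier F" "g \<in> carrier F"
  using that keys_add[of f g] by (auto simp: F_simps)

lemma scale_F [simp]: "scale_poly c f \<in> carrier F" if "f \<in> carrier F"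
  using that by (auto simp: F_simps in_keys_iff lookup_scale_poly subset_iff)

lemma uminus_F [simp]: "- f \<in> carrier F" if "f \<in> carrier F"
  using scale_F[OF that, of "- 1"] by (simp add: scale_poly_simps)

lemma diff_F [simp]: "f - g \<in> carrier F" if "f \<in> carrier F" "g \<in> carrier F"
  using add_F[of f "- g"] that by simp

lemma zero_F [simp]: "0 \<in> carrier F"
  by (simp add: F_simps)

lemma sum_F: "(\<And>s. s \<in> S \<Longrightarrow> f s \<in> carrier F) \<Longrightarrow> (\<Sum>s\<in>S. f s) \<in> carrier F"
  by (induction S rule: infinite_finite_induct) auto

lemma mult_F_eq:
  "f \<otimes>\<^bsub>F\<^esub> g = (\<Sum>x\<in>Poly_Mapping.keys f. \<Sum>y\<in>Poly_Mapping.keys g.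
    Poly_Mapping.single (fst x \<otimes>\<^bsub>A\<^esub> fst y, snd x \<otimes>\<^bsub>B\<^esub> snd y)
      (Poly_Mapping.lookup f x * Poly_Mapping.lookup g y))"
  by (simp add: tensor_free_def case_prod_beta)

lemma mult_F [simp]: "f \<otimes>\<^bsub>F\<^esub> g \<in> carrier F" if "f \<in> carrier F" "g \<in> carrier F"
  unfolding mult_F_eq using that
  by (intro sum_F single_F A.mult_closed B.mult_closed) (auto simp: F_simps(1))

lemma module_F: "Module.module class_ring F"
proof (rule module_criteria)
  show "cring (class_ring :: 'k ring)" by (rule class_cring.is_cring)
  show "\<forall>v\<in>carrier F. \<exists>neg_v\<in>carrier F. v \<oplus>\<^bsub>F\<^esub> neg_v = \<zero>\<^bsub>F\<^esub>"
  proof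
    fix v assume "v \<in> carrier F"
    then show "\<exists>w\<in>carrier F. v \<oplus>\<^bsub>F\<^esub> w = \<zero>\<^bsub>F\<^esub>"
      by (intro bexI[of _ "- v"]) (simp_all add: F_simps(2,3))
  qed
qed (auto simp: F_simps(2-4) scale_poly_simps algebra_simps simp del: map_eq_zero_iff)

sublocale F: Module.module class_ring F by (rule module_F)

subsection \<open>Matrix coordinates on the free space\<close>

text \<open>The guard settles positions outside the square, where \<open>fst x $$ p\<close> is
  unspecified, so that coordinates can later be compared as whole functions.\<close>

definition coord :: "('k mat \<times> 'b \<Rightarrow>\<^sub>0 'k) \<Rightarrow> nat \<times> nat \<Rightarrow> 'b" where
  "coord f p = (if p \<in> upper_pairs d
    then \<Oplus>\<^bsub>B\<^esub>x \<in> Poly_Mapping.keys f. (Poly_Mapping.lookup f x * fst x $$ p) \<odot>\<^bsub>B\<^esub> snd x else \<zero>\<^bsub>B\<^esub>)"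

lemma coord_outside: "p \<notin> upper_pairs d \<Longrightarrow> coord f p = \<zero>\<^bsub>B\<^esub>"
  by (simp add: coord_def)

text \<open>Summing over a larger set S lets elements with different supports be added over a common
  index set. Inside the square the guard of \<open>coord\<close> is automatic, because matrices in
  UT vanish off the pattern.\<close>

lemma coord_eq:
  assumes "finite S" "Poly_Mapping.keys f \<subseteq> S" "S \<subseteq> carrier A \<times> carrier B"
    and p: "p \<in> {..<n} \<times> {..<n}"
  shows "coord f p = (\<Oplus>\<^bsub>B\<^esub>x\<in>S. (Poly_Mapping.lookup f x * fst x $$ p) \<odot>\<^bsub>B\<^esub> snd x)"
proof (cases "p \<in> upper_pairs d")
  case True
  have "(\<Oplus>\<^bsub>B\<^esub>x \<in> Poly_Mapping.keys f. (Poly_Mapping.lookup f x * fst x $$ p) \<odot>\<^bsub>B\<^esub> snd x)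
      = (\<Oplus>\<^bsub>B\<^esub>x\<in>S. (Poly_Mapping.lookup f x * fst x $$ p) \<odot>\<^bsub>B\<^esub> snd x)"
    using assms
    by (intro B.add.finprod_mono_neutral_cong_left) (auto simp: in_keys_iff intro!: B.smult_closed)
  then show ?thesis using True by (simp add: coord_def)
next
  case False
  then have "fst x $$ p = 0" if "x \<in> S" for x
    using that assms(3) p by (cases p; cases x) (auto intro: UT_zero)
  then have "(\<Oplus>\<^bsub>B\<^esub>x\<in>S. (Poly_Mapping.lookup f x * fst x $$ p) \<odot>\<^bsub>B\<^esub> snd x) = (\<Oplus>\<^bsub>B\<^esub>x\<in>S. \<zero>\<^bsub>B\<^esub>)"
    using assms(3) by (intro B.finsum_cong') auto
  then show ?thesis using False by (simp add: coord_def)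
qed

lemma coord_closed [simp]: "f \<in> carrier F \<Longrightarrow> coord f p \<in> carrier B"
  by (auto simp: coord_def F_simps intro!: B.finsum_closed B.smult_closed)

lemma coord_add:
  assumes "f \<in> carrier F" "g \<in> carrier F"
  shows "coord (f + g) p = coord f p \<oplus>\<^bsub>B\<^esub> coord g p"
proof (cases "p \<in> upper_pairs d")
  case True
  let ?S = "Poly_Mapping.keys f \<union> Poly_Mapping.keys g"
  have S: "finite ?S" "Poly_Mapping.keys (f + g) \<subseteq> ?S" "?S \<subseteq> carrier A \<times> carrier B"
    using assms keys_add[of f g] by (auto simp: F_simps)
  have p: "p \<in> {..<n} \<times> {..<n}" by (rule upper_pairs_square[OF True])
  have "coord (f + g) p = (\<Oplus>\<^bsub>B\<^esub>x\<in>?S. (Poly_Mapping.lookup f x * fst x $$ p) \<odot>\<^bsub>B\<^esub> snd x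
      \<oplus>\<^bsub>B\<^esub> (Poly_Mapping.lookup g x * fst x $$ p) \<odot>\<^bsub>B\<^esub> snd x)"
    unfolding coord_eq[OF S p] using S(3) B.smult_l_distr
    by (intro B.finsum_cong') (auto simp: lookup_add algebra_simps intro!: B.add.m_closed B.smult_closed)
  also have "\<dots> = coord f p \<oplus>\<^bsub>B\<^esub> coord g p"
    using S(3) unfolding coord_eq[of ?S f, OF S(1) Un_upper1 S(3) p] coord_eq[of ?S g, OF S(1) Un_upper2 S(3) p]
    by (intro B.finsum_addf) (auto intro!: B.smult_closed)
  finally show ?thesis .
qed (simp add: coord_outside)

lemma coord_scale:
  assumes "f \<in> carrier F"
  shows "coord (scale_poly c f) p = c \<odot>\<^bsub>B\<^esub> coord f p"
proof (cases "p \<in> upper_pairs d")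
  case True
  let ?S = "Poly_Mapping.keys f"
  have S: "finite ?S" "Poly_Mapping.keys (scale_poly c f) \<subseteq> ?S" "?S \<subseteq> carrier A \<times> carrier B"
    using assms by (auto simp: F_simps in_keys_iff lookup_scale_poly)
  have p: "p \<in> {..<n} \<times> {..<n}" by (rule upper_pairs_square[OF True])
  have "coord (scale_poly c f) p
      = (\<Oplus>\<^bsub>B\<^esub>x\<in>?S. c \<odot>\<^bsub>B\<^esub> ((Poly_Mapping.lookup f x * fst x $$ p) \<odot>\<^bsub>B\<^esub> snd x))"
    unfolding coord_eq[OF S p] using S(3) B.smult_assoc1
    by (intro B.finsum_cong') (auto simp: lookup_scale_poly algebra_simps intro!: B.smult_closed)
  also have "\<dots> = c \<odot>\<^bsub>B\<^esub> coord f p"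
    using S(3) unfolding coord_eq[of ?S f, OF S(1) subset_refl S(3) p]
    by (intro B.finsum_smult[symmetric]) (auto intro!: B.smult_closed)
  finally show ?thesis .
qed (simp add: coord_outside)

lemma coord_zero [simp]: "coord 0 p = \<zero>\<^bsub>B\<^esub>"
  by (simp add: coord_def)

lemma coord_single:
  assumes "a \<in> carrier A" "b \<in> carrier B" "p \<in> {..<n} \<times> {..<n}"
  shows "coord (Poly_Mapping.single (a, b) c) p = (c * a $$ p) \<odot>\<^bsub>B\<^esub> b"
  using assms by (subst coord_eq[of "{(a, b)}"]) (auto split: if_splits)

lemma coord_sum:
  assumes "\<And>s. s \<in> S \<Longrightarrow> f s \<in> carrier F" "finite S"
  shows "coord (\<Sum>s\<in>S. f s) p = (\<Oplus>\<^bsub>B\<^esub>s\<in>S. coord (f s) p)"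
  using assms(2,1)
proof (induction S rule: finite_induct)
  case (insert s S)
  then have "(\<lambda>s. coord (f s) p) \<in> S \<rightarrow> carrier B" "(\<Sum>s\<in>S. f s) \<in> carrier F"
    by (auto intro: sum_F)
  then show ?case using insert by (simp add: coord_add)
qed simp

lemma smult_sum:
  assumes "b \<in> carrier B" "finite S"
  shows "(\<Sum>s\<in>S. c s) \<odot>\<^bsub>B\<^esub> b = (\<Oplus>\<^bsub>B\<^esub>s\<in>S. c s \<odot>\<^bsub>B\<^esub> b)"
  using assms(2)
proof (induction S rule: finite_induct)
  case (insert s S)
  then show ?case
    using assms(1) B.smult_l_distr[of "c s" "\<Sum>s\<in>S. c s" b] by (simp add: Pi_iff)
qed (use assms(1) in simp)

lemma smult_smult_mult:
  assumes "b \<in> carrier B" "b' \<in> carrier B"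
  shows "(c * c') \<odot>\<^bsub>B\<^esub> (b \<otimes>\<^bsub>B\<^esub> b') = (c \<odot>\<^bsub>B\<^esub> b) \<otimes>\<^bsub>B\<^esub> (c' \<odot>\<^bsub>B\<^esub> b')"
  using assms B.smult_assoc1[of c' c "b \<otimes>\<^bsub>B\<^esub> b'"]
  by (simp add: mult.commute B.smult_mult_l B.smult_mult_r B.mult_closed)

text \<open>Both sides expand to the sum of the products of \<open>X x k\<close> and
  \<open>Y y k\<close> over pairs (x, y) of basis elements and the middle index k. The left side has
  k innermost, the right side outermost, so the sums are interchanged.\<close>

lemma coord_mult:
  assumes f: "f \<in> carrier F" and g: "g \<in> carrier F" and ij: "i < n" "j < n"
  shows "coord (f \<otimes>\<^bsub>F\<^esub> g) (i, j) = (\<Oplus>\<^bsub>B\<^esub>k\<in>{..<n}. coord f (i, k) \<otimes>\<^bsub>B\<^esub> coord g (k, j))"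
proof -
  let ?K = "Poly_Mapping.keys f" and ?L = "Poly_Mapping.keys g"
  define X where "X x k = (Poly_Mapping.lookup f x * fst x $$ (i, k)) \<odot>\<^bsub>B\<^esub> snd x" for x k
  define Y where "Y y k = (Poly_Mapping.lookup g y * fst y $$ (k, j)) \<odot>\<^bsub>B\<^esub> snd y" for y k
  have K: "fst x \<in> carrier A" "snd x \<in> carrier B" if "x \<in> ?K" for x
    using f that by (auto simp: F_simps)
  have L: "fst x \<in> carrier A" "snd x \<in> carrier B" if "x \<in> ?L" for x
    using g that by (auto simp: F_simps)
  have X: "X x k \<in> carrier B" if "x \<in> ?K" for x k
    using K[OF that] by (simp add: X_def)
  have Y: "Y y k \<in> carrier B" if "y \<in> ?L" for y k
    using L[OF that] by (simp add: Y_def)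
  have Xs: "coord f (i, k) = (\<Oplus>\<^bsub>B\<^esub>x\<in>?K. X x k)" if "k < n" for k
    unfolding X_def using f that ij by (intro coord_eq) (auto simp: F_simps)
  have Ys: "coord g (k, j) = (\<Oplus>\<^bsub>B\<^esub>y\<in>?L. Y y k)" if "k < n" for k
    unfolding Y_def using g that ij by (intro coord_eq) (auto simp: F_simps)
  define m where "m x y = Poly_Mapping.single (fst x \<otimes>\<^bsub>A\<^esub> fst y, snd x \<otimes>\<^bsub>B\<^esub> snd y)
    (Poly_Mapping.lookup f x * Poly_Mapping.lookup g y)" for x y
  have m: "m x y \<in> carrier F" if "x \<in> ?K" "y \<in> ?L" for x y
    unfolding m_def using K[OF that(1)] L[OF that(2)]
    by (intro single_F A.mult_closed B.mult_closed) auto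
  \<comment> \<open>For one pair of basis elements the scalar contains the (i, j) entry of a matrix
    product; its sum over k is distributed over the factor from B.\<close>
  have coord_m: "coord (m x y) (i, j) = (\<Oplus>\<^bsub>B\<^esub>k\<in>{..<n}. X x k \<otimes>\<^bsub>B\<^esub> Y y k)"
    if xy: "x \<in> ?K" "y \<in> ?L" for x y
  proof -
    have "coord (m x y) (i, j) = (Poly_Mapping.lookup f x * Poly_Mapping.lookup g y *
        (\<Sum>k<n. fst x $$ (i, k) * fst y $$ (k, j))) \<odot>\<^bsub>B\<^esub> (snd x \<otimes>\<^bsub>B\<^esub> snd y)"
      unfolding m_def using K[OF xy(1)] L[OF xy(2)] ij
      by (subst coord_single) (simp_all add: A.mult_closed B.mult_closed UT_simps index_mult_UT mult_UT del: index_mult_mat)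
    also have "\<dots> = (\<Oplus>\<^bsub>B\<^esub>k\<in>{..<n}. (Poly_Mapping.lookup f x * Poly_Mapping.lookup g y *
        (fst x $$ (i, k) * fst y $$ (k, j))) \<odot>\<^bsub>B\<^esub> (snd x \<otimes>\<^bsub>B\<^esub> snd y))"
      unfolding sum_distrib_left
      by (rule smult_sum[OF B.mult_closed[OF K(2)[OF xy(1)] L(2)[OF xy(2)]]]) simp
    also have "\<dots> = (\<Oplus>\<^bsub>B\<^esub>k\<in>{..<n}. X x k \<otimes>\<^bsub>B\<^esub> Y y k)"
    proof (intro B.finsum_cong' refl)
      fix k
      show "(Poly_Mapping.lookup f x * Poly_Mapping.lookup g y * (fst x $$ (i, k) * fst y $$ (k, j)))
          \<odot>\<^bsub>B\<^esub> (snd x \<otimes>\<^bsub>B\<^esub> snd y) = X x k \<otimes>\<^bsub>B\<^esub> Y y k"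
        unfolding X_def Y_def smult_smult_mult[OF K(2)[OF xy(1)] L(2)[OF xy(2)], symmetric]
        by (simp add: mult_ac)
    qed (auto intro!: B.mult_closed X Y xy)
    finally show ?thesis .
  qed
  have XY: "X x k \<otimes>\<^bsub>B\<^esub> Y y k \<in> carrier B" if "x \<in> ?K" "y \<in> ?L" for x y k
    using that by (intro B.mult_closed X Y)
  have "coord (f \<otimes>\<^bsub>F\<^esub> g) (i, j) = coord (\<Sum>x\<in>?K. \<Sum>y\<in>?L. m x y) (i, j)"
    by (simp add: mult_F_eq m_def)
  also have "\<dots> = (\<Oplus>\<^bsub>B\<^esub>x\<in>?K. coord (\<Sum>y\<in>?L. m x y) (i, j))"
    by (intro coord_sum sum_F m) auto
  also have "\<dots> = (\<Oplus>\<^bsub>B\<^esub>x\<in>?K. \<Oplus>\<^bsub>B\<^esub>y\<in>?L. \<Oplus>\<^bsub>B\<^esub>k\<in>{..<n}. X x k \<otimes>\<^bsub>B\<^esub> Y y k)"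
  proof (intro B.finsum_cong' refl)
    fix x assume x: "x \<in> ?K"
    have "coord (\<Sum>y\<in>?L. m x y) (i, j) = (\<Oplus>\<^bsub>B\<^esub>y\<in>?L. coord (m x y) (i, j))"
      by (intro coord_sum m x) auto
    also have "\<dots> = (\<Oplus>\<^bsub>B\<^esub>y\<in>?L. \<Oplus>\<^bsub>B\<^esub>k\<in>{..<n}. X x k \<otimes>\<^bsub>B\<^esub> Y y k)"
      using x by (intro B.finsum_cong' refl coord_m) (auto intro!: B.finsum_closed XY)
    finally show "coord (\<Sum>y\<in>?L. m x y) (i, j) = (\<Oplus>\<^bsub>B\<^esub>y\<in>?L. \<Oplus>\<^bsub>B\<^esub>k\<in>{..<n}. X x k \<otimes>\<^bsub>B\<^esub> Y y k)" .
  qed (auto intro!: B.finsum_closed XY)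
  also have "\<dots> = (\<Oplus>\<^bsub>B\<^esub>x\<in>?K. \<Oplus>\<^bsub>B\<^esub>k\<in>{..<n}. \<Oplus>\<^bsub>B\<^esub>y\<in>?L. X x k \<otimes>\<^bsub>B\<^esub> Y y k)"
  proof (rule B.finsum_cong'[OF refl])
    fix x assume "x \<in> ?K"
    then show "(\<Oplus>\<^bsub>B\<^esub>y\<in>?L. \<Oplus>\<^bsub>B\<^esub>k\<in>{..<n}. X x k \<otimes>\<^bsub>B\<^esub> Y y k)
        = (\<Oplus>\<^bsub>B\<^esub>k\<in>{..<n}. \<Oplus>\<^bsub>B\<^esub>y\<in>?L. X x k \<otimes>\<^bsub>B\<^esub> Y y k)"
      by (intro B.finsum_swap XY) auto
  qed (auto intro!: B.finsum_closed XY)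
  also have "\<dots> = (\<Oplus>\<^bsub>B\<^esub>k\<in>{..<n}. \<Oplus>\<^bsub>B\<^esub>x\<in>?K. \<Oplus>\<^bsub>B\<^esub>y\<in>?L. X x k \<otimes>\<^bsub>B\<^esub> Y y k)"
    by (rule B.finsum_swap) (auto intro!: B.finsum_closed XY)
  also have "\<dots> = (\<Oplus>\<^bsub>B\<^esub>k\<in>{..<n}. coord f (i, k) \<otimes>\<^bsub>B\<^esub> coord g (k, j))"
  proof (intro B.finsum_cong' refl)
    fix k assume "k \<in> {..<n}"
    then have k: "k < n" by simp
    have "coord f (i, k) \<otimes>\<^bsub>B\<^esub> coord g (k, j) = (\<Oplus>\<^bsub>B\<^esub>x\<in>?K. X x k \<otimes>\<^bsub>B\<^esub> coord g (k, j))"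
      unfolding Xs[OF k] using g X by (intro B.finsum_mult_right) auto
    also have "\<dots> = (\<Oplus>\<^bsub>B\<^esub>x\<in>?K. \<Oplus>\<^bsub>B\<^esub>y\<in>?L. X x k \<otimes>\<^bsub>B\<^esub> Y y k)"
      unfolding Ys[OF k] using X Y
      by (intro B.finsum_cong' refl B.finsum_mult_left) (auto intro!: B.finsum_closed XY)
    finally show "(\<Oplus>\<^bsub>B\<^esub>x\<in>?K. \<Oplus>\<^bsub>B\<^esub>y\<in>?L. X x k \<otimes>\<^bsub>B\<^esub> Y y k) = coord f (i, k) \<otimes>\<^bsub>B\<^esub> coord g (k, j)" ..
  qed (auto intro!: B.mult_closed coord_closed f g)
  finally show ?thesis .
qed

end

context tensor_UT
begin

subsection \<open>The tensor ideal is the kernel of the coordinates\<close>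

lemma relators_F: "tensor_relators A B \<subseteq> carrier F"
  unfolding tensor_relators_def
  by (auto intro!: diff_F single_F A.smult_closed B.smult_closed A.add.m_closed B.add.m_closed)

lemma submodule_I: "LinearCombinations.submodule class_ring I F"
  unfolding tensor_ideal_def by (rule F.span_is_submodule[OF relators_F])

lemma relators_I: "tensor_relators A B \<subseteq> I"
  unfolding tensor_ideal_def by (rule F.in_own_span[OF relators_F])

lemma I_F: "f \<in> I \<Longrightarrow> f \<in> carrier F"
  using LinearCombinations.submodule.subset[OF submodule_I] by blast

lemma add_I: "f \<in> I \<Longrightarrow> g \<in> I \<Longrightarrow> f + g \<in> I"
  using LinearCombinations.submodule.m_closed[OF submodule_I] by (simp add: F_simps(3))

lemma zero_I: "0 \<in> I"
  using LinearCombinations.submodule.zero_closed[OF submodule_I] by (simp add: F_simps(2))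

lemma scale_I: "f \<in> I \<Longrightarrow> scale_poly c f \<in> I"
  using LinearCombinations.submodule.smult_closed[OF submodule_I, of c f] by (simp add: F_simps(4))

lemma uminus_I: "f \<in> I \<Longrightarrow> - f \<in> I"
  using scale_I[of f "- 1"] by (simp add: scale_poly_simps)

lemma sum_I: "(\<And>s. s \<in> S \<Longrightarrow> f s \<in> I) \<Longrightarrow> (\<Sum>s\<in>S. f s) \<in> I"
  by (induction S rule: infinite_finite_induct) (auto intro: add_I zero_I)

text \<open>The elements with zero coordinates form a subspace, so it suffices to check the four
  families of relators, each of which reflects one bilinearity law of the products a_ij b.\<close>

lemma coord_I:
  assumes "f \<in> I"
  shows "coord f p = \<zero>\<^bsub>B\<^esub>"
proof -
  let ?K = "{f \<in> carrier F. \<forall>p. coord f p = \<zero>\<^bsub>B\<^esub>}"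
  have sub: "LinearCombinations.submodule class_ring ?K F"
  proof (rule LinearCombinations.submodule.intro)
    show "Module.module class_ring F" by (rule module_F)
  qed (auto simp: F_simps(2-4) coord_add coord_scale)
  \<comment> \<open>Differences are treated by cancelling \<open>coord g p\<close>, so additivity of
    \<open>coord\<close> is enough.\<close>
  have diff: "coord (f - g) p = \<zero>\<^bsub>B\<^esub>" if "f \<in> carrier F" "g \<in> carrier F" "coord f p = coord g p" for f g p
  proof -
    have "coord (f - g) p \<oplus>\<^bsub>B\<^esub> coord g p = coord g p"
      using coord_add[OF diff_F[OF that(1,2)] that(2), of p] that(3) by (simp only: diff_add_cancel)
    then show ?thesis
      using B.add.r_cancel_one[OF coord_closed[OF that(2)] coord_closed[OF diff_F[OF that(1,2)]]]
      by blast
  qed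
  have "tensor_relators A B \<subseteq> ?K"
  proof
    fix x assume x: "x \<in> tensor_relators A B"
    have "coord x p = \<zero>\<^bsub>B\<^esub>" for p
    proof (cases "p \<in> upper_pairs d")
      case True
      then have p: "p \<in> {..<n} \<times> {..<n}" by (rule upper_pairs_square)
      have add: "(a \<oplus>\<^bsub>A\<^esub> a') $$ p = a $$ p + a' $$ p" if "a \<in> carrier A" "a' \<in> carrier A" for a a'
        using p UT_mat[OF that(1)] UT_mat[OF that(2)] by (auto simp: UT_simps)
      have smult: "(c \<odot>\<^bsub>A\<^esub> a) $$ p = c * a $$ p" if "a \<in> carrier A" for a c
        using p UT_mat[OF that] by (auto simp: UT_simps)
      have distr: "(c + c') \<odot>\<^bsub>B\<^esub> b = c \<odot>\<^bsub>B\<^esub> b \<oplus>\<^bsub>B\<^esub> c' \<odot>\<^bsub>B\<^esub> b" if "b \<in> carrier B" for b c c'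
        using B.smult_l_distr[of c c' b] that by simp
      have assoc: "c \<odot>\<^bsub>B\<^esub> (c' \<odot>\<^bsub>B\<^esub> b) = (c * c') \<odot>\<^bsub>B\<^esub> b" if "b \<in> carrier B" for b c c'
        using B.smult_assoc1[of c c' b] that by simp
      from x consider
        (1) a a' b where "x = Poly_Mapping.single (a \<oplus>\<^bsub>A\<^esub> a', b) 1 - Poly_Mapping.single (a, b) 1
            - Poly_Mapping.single (a', b) 1" "a \<in> carrier A" "a' \<in> carrier A" "b \<in> carrier B"
        | (2) a b b' where "x = Poly_Mapping.single (a, b \<oplus>\<^bsub>B\<^esub> b') 1 - Poly_Mapping.single (a, b) 1
            - Poly_Mapping.single (a, b') 1" "a \<in> carrier A" "b \<in> carrier B" "b' \<in> carrier B"
        | (3) a b c where "x = Poly_Mapping.single (c \<odot>\<^bsub>A\<^esub> a, b) 1 - Poly_Mapping.single (a, b) c"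
            "a \<in> carrier A" "b \<in> carrier B"
        | (4) a b c where "x = Poly_Mapping.single (a, c \<odot>\<^bsub>B\<^esub> b) 1 - Poly_Mapping.single (a, b) c"
            "a \<in> carrier A" "b \<in> carrier B"
        unfolding tensor_relators_def by blast
      then show ?thesis
      proof cases
        case 1
        then show ?thesis unfolding 1(1) diff_diff_eq using p
          by (intro diff) (simp_all add: coord_add coord_single add distr)
      next
        case 2
        then show ?thesis unfolding 2(1) diff_diff_eq using p
          by (intro diff) (simp_all add: coord_add coord_single B.smult_r_distr)
      next
        case 3
        then show ?thesis unfolding 3(1) using p
          by (intro diff) (simp_all add: coord_single smult A.smult_closed)
      next
        case 4
        then show ?thesis unfolding 4(1) using p
          by (intro diff) (simp_all add: coord_single assoc mult.commute B.smult_closed)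
      qed
    qed (simp add: coord_outside)
    then show "x \<in> ?K" using x relators_F by auto
  qed
  then have "I \<subseteq> ?K" unfolding tensor_ideal_def by (rule F.span_is_subset[OF _ sub])
  then show ?thesis using assms by blast
qed

text \<open>Congruence modulo the ideal is made an infix relation with a transitivity rule so that
  manipulations of tensors can be written as calculations.\<close>

definition cong_I (infix \<open>\<approx>\<close> 50) where "f \<approx> g \<longleftrightarrow> f - g \<in> I"

lemma cong_refl: "f \<approx> f"
  by (simp add: cong_I_def zero_I)

lemma cong_sym: "f \<approx> g \<Longrightarrow> g \<approx> f"
  using uminus_I[of "f - g"] by (simp add: cong_I_def)

lemma cong_trans [trans]: "f \<approx> g \<Longrightarrow> g \<approx> h \<Longrightarrow> f \<approx> h"
  using add_I[of "f - g" "g - h"] by (simp add: cong_I_def)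

lemma cong_sum: "(\<And>s. s \<in> S \<Longrightarrow> f s \<approx> g s) \<Longrightarrow> (\<Sum>s\<in>S. f s) \<approx> (\<Sum>s\<in>S. g s)"
  unfolding cong_I_def sum_subtractf[symmetric] by (rule sum_I)

lemma cong_add: "f \<approx> g \<Longrightarrow> f' \<approx> g' \<Longrightarrow> f + f' \<approx> g + g'"
  using add_I[of "f - g" "f' - g'"] by (simp add: cong_I_def algebra_simps)

lemma cong_relators:
  assumes "a \<in> carrier A" "b \<in> carrier B"
  shows "a' \<in> carrier A \<Longrightarrow> Poly_Mapping.single (a \<oplus>\<^bsub>A\<^esub> a', b) 1
      \<approx> Poly_Mapping.single (a, b) 1 + Poly_Mapping.single (a', b) 1"
    and "b' \<in> carrier B \<Longrightarrow> Poly_Mapping.single (a, b \<oplus>\<^bsub>B\<^esub> b') 1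
      \<approx> Poly_Mapping.single (a, b) 1 + Poly_Mapping.single (a, b') 1"
    and "Poly_Mapping.single (c \<odot>\<^bsub>A\<^esub> a, b) 1 \<approx> Poly_Mapping.single (a, b) c"
    and "Poly_Mapping.single (a, c \<odot>\<^bsub>B\<^esub> b) 1 \<approx> Poly_Mapping.single (a, b) c"
  unfolding cong_I_def diff_diff_eq[symmetric]
  by (rule subsetD[OF relators_I]; use assms in \<open>unfold tensor_relators_def; blast\<close>)+

lemma cong_finsum_left:
  assumes "finite S" "f \<in> S \<rightarrow> carrier A" "b \<in> carrier B"
  shows "Poly_Mapping.single (\<Oplus>\<^bsub>A\<^esub>s\<in>S. f s, b) 1 \<approx> (\<Sum>s\<in>S. Poly_Mapping.single (f s, b) 1)"
  using assms(1,2)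
proof (induction S rule: finite_induct)
  \<comment> \<open>The empty sum gives the pair (0, b). The scalar relator at 0 makes it congruent
    to a basis vector with coefficient 0, which is zero.\<close>
  case empty
  then show ?case
    using cong_relators(3)[of "\<zero>\<^bsub>A\<^esub>" b 0] assms(3) by simp
next
  case (insert s S)
  then have f: "f s \<in> carrier A" "f \<in> S \<rightarrow> carrier A" by auto
  have "Poly_Mapping.single (f s \<oplus>\<^bsub>A\<^esub> (\<Oplus>\<^bsub>A\<^esub>s\<in>S. f s), b) 1
      \<approx> Poly_Mapping.single (f s, b) 1 + Poly_Mapping.single (\<Oplus>\<^bsub>A\<^esub>s\<in>S. f s, b) (1 :: 'k)"
    using f assms(3) by (intro cong_relators A.finsum_closed)
  also have "\<dots> \<approx> Poly_Mapping.single (f s, b) 1 + (\<Sum>s\<in>S. Poly_Mapping.single (f s, b) 1)"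
    by (intro cong_add cong_refl insert.IH f)
  finally show ?case using insert.hyps f by simp
qed

lemma cong_finsum_right:
  assumes "finite S" "f \<in> S \<rightarrow> carrier B" "a \<in> carrier A"
  shows "Poly_Mapping.single (a, \<Oplus>\<^bsub>B\<^esub>s\<in>S. f s) 1 \<approx> (\<Sum>s\<in>S. Poly_Mapping.single (a, f s) 1)"
  using assms(1,2)
proof (induction S rule: finite_induct)
  case empty
  then show ?case
    using cong_relators(4)[of a "\<zero>\<^bsub>B\<^esub>" 0] assms(3) by simp
next
  case (insert s S)
  then have f: "f s \<in> carrier B" "f \<in> S \<rightarrow> carrier B" by auto
  have "Poly_Mapping.single (a, f s \<oplus>\<^bsub>B\<^esub> (\<Oplus>\<^bsub>B\<^esub>s\<in>S. f s)) 1
      \<approx> Poly_Mapping.single (a, f s) 1 + Poly_Mapping.single (a, \<Oplus>\<^bsub>B\<^esub>s\<in>S. f s) (1 :: 'k)"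
    using f assms(3) by (intro cong_relators B.finsum_closed)
  also have "\<dots> \<approx> Poly_Mapping.single (a, f s) 1 + (\<Sum>s\<in>S. Poly_Mapping.single (a, f s) 1)"
    by (intro cong_add cong_refl insert.IH f)
  finally show ?case using insert.hyps f by simp
qed

abbreviation E :: "nat \<times> nat \<Rightarrow> 'k mat" where
  "E p \<equiv> unit_mat n (fst p) (snd p)"

lemma E_A: "p \<in> upper_pairs d \<Longrightarrow> E p \<in> carrier A"
  by (cases p) (auto simp: unit_mat_UT upper_pairs_less)

lemma coord_single_E:
  assumes "p \<in> upper_pairs d" "q \<in> upper_pairs d" "b \<in> carrier B"
  shows "coord (Poly_Mapping.single (E p, b) 1) q = (if q = p then b else \<zero>\<^bsub>B\<^esub>)"
  using coord_single[OF E_A[OF assms(1)] assms(3) upper_pairs_square[OF assms(2)], of 1]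
    upper_pairs_square[OF assms(2)] assms(3)
  by (cases p; cases q) (auto simp: unit_mat_def)

text \<open>Expand a in matrix units and push every scalar into the factor from B. The coefficient c
  is absorbed there too, since the normal form has coefficients 1 only.\<close>

lemma cong_single:
  assumes a: "a \<in> carrier A" and b: "b \<in> carrier B"
  shows "Poly_Mapping.single (a, b) c
    \<approx> (\<Sum>p\<in>upper_pairs d. Poly_Mapping.single (E p, (c * a $$ p) \<odot>\<^bsub>B\<^esub> b) 1)"
proof -
  have cb: "c \<odot>\<^bsub>B\<^esub> b \<in> carrier B" using b by (intro B.smult_closed) auto
  have "Poly_Mapping.single (a, b) c \<approx> Poly_Mapping.single (a, c \<odot>\<^bsub>B\<^esub> b) 1"
    by (rule cong_sym[OF cong_relators(4)[OF a b]])
  also have "\<dots> = Poly_Mapping.single (\<Oplus>\<^bsub>A\<^esub>p\<in>upper_pairs d. a $$ p \<odot>\<^bsub>A\<^esub> E p, c \<odot>\<^bsub>B\<^esub> b) 1"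
    by (subst UT_sum_unit_mat[OF a subset_refl]) auto
  also have "\<dots> \<approx> (\<Sum>p\<in>upper_pairs d. Poly_Mapping.single (a $$ p \<odot>\<^bsub>A\<^esub> E p, c \<odot>\<^bsub>B\<^esub> b) 1)"
    by (intro cong_finsum_left finite_upper_pairs cb) (auto intro!: A.smult_closed E_A)
  also have "\<dots> \<approx> (\<Sum>p\<in>upper_pairs d. Poly_Mapping.single (E p, (c * a $$ p) \<odot>\<^bsub>B\<^esub> b) 1)"
  proof (rule cong_sum)
    fix p assume "p \<in> upper_pairs d"
    then have E: "E p \<in> carrier A" by (rule E_A)
    have "Poly_Mapping.single (a $$ p \<odot>\<^bsub>A\<^esub> E p, c \<odot>\<^bsub>B\<^esub> b) 1 \<approx> Poly_Mapping.single (E p, c \<odot>\<^bsub>B\<^esub> b) (a $$ p)"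
      by (rule cong_relators(3)[OF E cb])
    also have "\<dots> \<approx> Poly_Mapping.single (E p, a $$ p \<odot>\<^bsub>B\<^esub> (c \<odot>\<^bsub>B\<^esub> b)) 1"
      by (rule cong_sym[OF cong_relators(4)[OF E cb]])
    also have "a $$ p \<odot>\<^bsub>B\<^esub> (c \<odot>\<^bsub>B\<^esub> b) = (c * a $$ p) \<odot>\<^bsub>B\<^esub> b"
      using B.smult_assoc1[of "a $$ p" c b] b by (simp add: mult.commute)
    finally show "Poly_Mapping.single (a $$ p \<odot>\<^bsub>A\<^esub> E p, c \<odot>\<^bsub>B\<^esub> b) 1
        \<approx> Poly_Mapping.single (E p, (c * a $$ p) \<odot>\<^bsub>B\<^esub> b) 1" .
  qed
  finally show ?thesis .
qed

text \<open>This supplies the half of the kernel statement that \<open>coord_I\<close> leaves open: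
  modulo I an element can be rebuilt from its coordinates. The basis of matrix units of UT suffices
  for this; no basis of B is chosen.\<close>

lemma cong_normal_form:
  assumes f: "f \<in> carrier F"
  shows "f \<approx> (\<Sum>p\<in>upper_pairs d. Poly_Mapping.single (E p, coord f p) 1)"
proof -
  let ?K = "Poly_Mapping.keys f"
  let ?t = "\<lambda>x p. (Poly_Mapping.lookup f x * fst x $$ p) \<odot>\<^bsub>B\<^esub> snd x"
  have K: "fst x \<in> carrier A" "snd x \<in> carrier B" if "x \<in> ?K" for x
    using f that by (auto simp: F_simps(1))
  have "f = (\<Sum>x\<in>?K. Poly_Mapping.single (fst x, snd x) (Poly_Mapping.lookup f x))"
    by (simp add: poly_mapping_sum_single)
  also have "\<dots> \<approx> (\<Sum>x\<in>?K. \<Sum>p\<in>upper_pairs d. Poly_Mapping.single (E p, ?t x p) 1)"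
    by (intro cong_sum cong_single K)
  also have "\<dots> = (\<Sum>p\<in>upper_pairs d. \<Sum>x\<in>?K. Poly_Mapping.single (E p, ?t x p) 1)"
    by (rule sum.swap)
  \<comment> \<open>For a fixed matrix unit, additivity in the second factor merges the
    contributions of all basis elements into one.\<close>
  also have "\<dots> \<approx> (\<Sum>p\<in>upper_pairs d. Poly_Mapping.single (E p, coord f p) 1)"
  proof (rule cong_sum)
    fix p assume p: "p \<in> upper_pairs d"
    then have "coord f p = (\<Oplus>\<^bsub>B\<^esub>x\<in>?K. ?t x p)" by (simp add: coord_def)
    then show "(\<Sum>x\<in>?K. Poly_Mapping.single (E p, ?t x p) 1) \<approx> Poly_Mapping.single (E p, coord f p) 1"
      using K p
      by (auto intro!: cong_sym[OF cong_finsum_right] E_A B.smult_closed)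
  qed
  finally show ?thesis .
qed

lemma cong_iff_coord:
  assumes f: "f \<in> carrier F" and g: "g \<in> carrier F"
  shows "f \<approx> g \<longleftrightarrow> coord f = coord g"
proof
  assume "f \<approx> g"
  then have "coord ((f - g) + g) p = coord g p" for p
    using coord_add[of "f - g" g p] f g coord_I[of "f - g" p] by (simp add: cong_I_def)
  then show "coord f = coord g" by (simp add: fun_eq_iff)
next
  assume eq: "coord f = coord g"
  show "f \<approx> g"
    using cong_normal_form[OF f] unfolding eq by (rule cong_trans[OF _ cong_sym[OF cong_normal_form[OF g]]])
qed

subsection \<open>Coordinates on the tensor product\<close>

abbreviation R where "R \<equiv> tensor_algebra A B"

definition coset :: "('k mat \<times> 'b \<Rightarrow>\<^sub>0 'k) \<Rightarrow> ('k mat \<times> 'b \<Rightarrow>\<^sub>0 'k) set" where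
  "coset f = I +>\<^bsub>F\<^esub> f"

lemma coset_eq: "coset f = {h + f | h. h \<in> I}"
  by (auto simp: coset_def a_r_coset_def' F_simps(3))

text \<open>Membership in a coset becomes a condition on coordinates, which is how independence of
  representatives is checked for products and scalar multiples.\<close>

lemma mem_coset: "f \<in> carrier F \<Longrightarrow> g \<in> coset f \<longleftrightarrow> g \<in> carrier F \<and> coord g = coord f"
proof -
  assume f: "f \<in> carrier F"
  have "g \<in> coset f \<longleftrightarrow> g \<approx> f"
    unfolding coset_eq cong_I_def by (auto simp: algebra_simps) (metis diff_add_cancel)
  moreover have "g \<in> carrier F" if "g \<approx> f"
    using add_F[OF I_F[of "g - f"] f] that by (simp add: cong_I_def)
  ultimately show ?thesis using cong_iff_coord[of g f] f by blast
qed

lemma coset_eq_iff: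
  assumes "f \<in> carrier F" "g \<in> carrier F"
  shows "coset f = coset g \<longleftrightarrow> coord f = coord g"
  using assms mem_coset by (metis (full_types) subsetI subset_antisym)

lemma self_coset: "f \<in> carrier F \<Longrightarrow> f \<in> coset f"
  by (simp add: mem_coset)

lemma carrier_R: "carrier R = coset ` carrier F"
  by (auto simp: tensor_algebra_def ring.defs module.defs FactRing_def A_RCOSETS_def' coset_def)

lemma zero_R: "\<zero>\<^bsub>R\<^esub> = coset 0"
  by (simp add: tensor_algebra_def ring.defs module.defs FactRing_def coset_eq)

lemma add_R:
  assumes "f \<in> carrier F" "g \<in> carrier F"
  shows "coset f \<oplus>\<^bsub>R\<^esub> coset g = coset (f + g)"
proof -
  have "coset f \<oplus>\<^bsub>R\<^esub> coset g = {x + y | x y. x \<in> coset f \<and> y \<in> coset g}"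
    by (auto simp: tensor_algebra_def ring.defs module.defs FactRing_def set_add_def' F_simps(3))
  also have "\<dots> = coset (f + g)"
  proof (intro equalityI subsetI)
    fix z assume "z \<in> {x + y | x y. x \<in> coset f \<and> y \<in> coset g}"
    then obtain h h' where "h \<in> I" "h' \<in> I" "z = (h + f) + (h' + g)" by (auto simp: coset_eq)
    then show "z \<in> coset (f + g)"
      using add_I[of h h'] unfolding coset_eq by (auto simp: algebra_simps intro!: exI[of _ "h + h'"])
  next
    fix z assume "z \<in> coset (f + g)"
    then obtain h where h: "h \<in> I" "z = (h + f) + (0 + g)" by (auto simp: coset_eq algebra_simps)
    show "z \<in> {x + y | x y. x \<in> coset f \<and> y \<in> coset g}"
      using h zero_I unfolding coset_eq by blast
  qed
  finally show ?thesis .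
qed

text \<open>The product of cosets is a union over all pairs of representatives. By
  \<open>coord_mult\<close> the coordinates of a product depend only on those of the factors, so all
  members of the union are one coset; this does the work of the ideal property of I.\<close>

lemma mult_R:
  assumes f: "f \<in> carrier F" and g: "g \<in> carrier F"
  shows "coset f \<otimes>\<^bsub>R\<^esub> coset g = coset (f \<otimes>\<^bsub>F\<^esub> g)"
proof -
  have "coset f \<otimes>\<^bsub>R\<^esub> coset g = (\<Union>x\<in>coset f. \<Union>y\<in>coset g. coset (x \<otimes>\<^bsub>F\<^esub> y))"
    by (simp add: tensor_algebra_def ring.defs module.defs FactRing_def rcoset_mult_def coset_def)
  moreover have "coset (x \<otimes>\<^bsub>F\<^esub> y) = coset (f \<otimes>\<^bsub>F\<^esub> g)" if "x \<in> coset f" "y \<in> coset g" for x y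
  proof -
    have xy: "x \<in> carrier F" "coord x = coord f" "y \<in> carrier F" "coord y = coord g"
      using that mem_coset f g by blast+
    have "coord (x \<otimes>\<^bsub>F\<^esub> y) p = coord (f \<otimes>\<^bsub>F\<^esub> g) p" for p
    proof (cases "p \<in> upper_pairs d")
      case True
      then show ?thesis using xy f g by (cases p) (simp add: coord_mult upper_pairs_less)
    qed (simp add: coord_outside)
    then show ?thesis using xy f g by (simp add: coset_eq_iff fun_eq_iff)
  qed
  ultimately show ?thesis using self_coset[OF f] self_coset[OF g] by blast
qed

lemma smult_R:
  assumes f: "f \<in> carrier F"
  shows "c \<odot>\<^bsub>R\<^esub> coset f = coset (scale_poly c f)"
proof -
  have "c \<odot>\<^bsub>R\<^esub> coset f = (\<Union>x\<in>coset f. coset (scale_poly c x))"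
    by (simp add: tensor_algebra_def ring.defs module.defs coset_def F_simps(4))
  moreover have "coset (scale_poly c x) = coset (scale_poly c f)" if "x \<in> coset f" for x
  proof -
    have x: "x \<in> carrier F" "coord x = coord f" using that mem_coset f by blast+
    then show ?thesis using f by (simp add: coset_eq_iff fun_eq_iff coord_scale)
  qed
  ultimately show ?thesis using self_coset[OF f] by blast
qed

lemma module_R: "Module.module class_ring R"
proof (rule module_criteria)
  show "cring (class_ring :: 'k ring)" by (rule class_cring.is_cring)
  show "\<forall>v\<in>carrier R. \<exists>w\<in>carrier R. v \<oplus>\<^bsub>R\<^esub> w = \<zero>\<^bsub>R\<^esub>"
  proof
    fix v assume "v \<in> carrier R"
    then obtain f where "f \<in> carrier F" "v = coset f" by (auto simp: carrier_R)
    then show "\<exists>w\<in>carrier R. v \<oplus>\<^bsub>R\<^esub> w = \<zero>\<^bsub>R\<^esub>"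
      by (intro bexI[of _ "coset (- f)"]) (simp_all add: carrier_R zero_R add_R)
  qed
qed (auto simp: carrier_R zero_R add_R smult_R scale_poly_simps ac_simps)

sublocale R: Module.module class_ring R by (rule module_R)

text \<open>The choice of a representative does not matter, as all elements of a coset have the same
  coordinates.\<close>

definition tensor_entry :: "('k mat \<times> 'b \<Rightarrow>\<^sub>0 'k) set \<Rightarrow> nat \<times> nat \<Rightarrow> 'b" where
  "tensor_entry X = coord (SOME f. f \<in> X)"

lemma tensor_entry_coset: "f \<in> carrier F \<Longrightarrow> tensor_entry (coset f) = coord f"
  unfolding tensor_entry_def by (rule someI2[of _ f]) (auto simp: mem_coset)

sublocale matrix_coordinates R B n "upper_pairs d" tensor_entry
proof unfold_locales
  show "upper_pairs d \<subseteq> {..<n} \<times> {..<n}" using upper_pairs_square by blast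
next
  fix b :: "nat \<times> nat \<Rightarrow> 'b"
  assume b: "\<And>p. p \<in> upper_pairs d \<Longrightarrow> b p \<in> carrier B"
  \<comment> \<open>The normal form with the prescribed entries is the representative.\<close>
  define f where "f = (\<Sum>p\<in>upper_pairs d. Poly_Mapping.single (E p, b p) (1 :: 'k))"
  have f: "f \<in> carrier F" unfolding f_def by (intro sum_F single_F E_A b)
  have "coord f q = b q" if q: "q \<in> upper_pairs d" for q
  proof -
    have "coord f q = (\<Oplus>\<^bsub>B\<^esub>p\<in>upper_pairs d. coord (Poly_Mapping.single (E p, b p) 1) q)"
      unfolding f_def by (intro coord_sum single_F E_A b finite_upper_pairs)
    also have "\<dots> = (\<Oplus>\<^bsub>B\<^esub>p\<in>upper_pairs d. if q = p then b p else \<zero>\<^bsub>B\<^esub>)"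
      using q b by (intro B.finsum_cong') (auto simp: coord_single_E)
    also have "\<dots> = b q"
      using q b by (intro B.finsum_singleton finite_upper_pairs) auto
    finally show ?thesis .
  qed
  then show "\<exists>x\<in>carrier R. \<forall>p\<in>upper_pairs d. tensor_entry x p = b p"
    using f by (intro bexI[of _ "coset f"]) (auto simp: tensor_entry_coset carrier_R)
next
  fix x y assume "x \<in> carrier R" "y \<in> carrier R"
    and eq: "\<And>p. p \<in> upper_pairs d \<Longrightarrow> tensor_entry x p = tensor_entry y p"
  then obtain f g where fg: "f \<in> carrier F" "x = coset f" "g \<in> carrier F" "y = coset g"
    by (auto simp: carrier_R)
  then have "coord f p = coord g p" for p
    using eq by (cases "p \<in> upper_pairs d") (simp_all add: tensor_entry_coset coord_outside)
  then show "x = y" using fg by (simp add: coset_eq_iff fun_eq_iff)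
qed (auto simp: carrier_R add_R smult_R mult_R tensor_entry_coset coord_add coord_scale coord_mult
  coord_outside)

lemma pure_R: "a \<in> carrier A \<Longrightarrow> b \<in> carrier B \<Longrightarrow> pure_tensor A B a b \<in> carrier R"
  by (simp add: pure_tensor_def carrier_R flip: coset_def)

lemma entry_pure:
  assumes "p \<in> upper_pairs d" "b \<in> carrier B"
  shows "tensor_entry (pure_tensor A B (E p) b) q = (if q = p then b else \<zero>\<^bsub>B\<^esub>)"
proof (cases "q \<in> upper_pairs d")
  case True
  then show ?thesis
    using assms E_A[OF assms(1)]
    by (simp add: pure_tensor_def tensor_entry_coset coord_single_E flip: coset_def)
next
  case False
  then show ?thesis using assms entry_outside[OF pure_R[OF E_A assms(2)]] by auto
qed

subsection \<open>Coarsened gradings\<close>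

text \<open>A nonzero generator at (i, j) has its factor from B in a degree of H, so its coarse
  degree is that of the position. Conversely, the homogeneous parts of an arbitrary element of B
  give generators at (i, j) whose degrees in G may differ but share one coset, so the span fills the
  whole entry.\<close>

lemma coarsening_tensor_grading:
  assumes comm: "comm_group G" and gs: "length gs = n" "set gs \<subseteq> carrier G"
    and grad: "graded_algebra G B \<Gamma>"
    and H: "subgroup H G" and supp: "grading_support G B \<Gamma> = H"
  shows "coarsening G (\<lambda>g. H #>\<^bsub>G\<^esub> g) R (tensor_grading G d gs B \<Gamma>) q
    = component {(i, j) \<in> upper_pairs d.
        (H #>\<^bsub>G\<^esub> gs ! i) \<otimes>\<^bsub>G Mod H\<^esub> inv\<^bsub>G Mod H\<^esub> (H #>\<^bsub>G\<^esub> gs ! j) = q}"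
    (is "_ = component ?D")
proof -
  interpret G: comm_group G by fact
  interpret \<Gamma>: graded_algebra G B \<Gamma> by fact
  interpret H: normal H G by (rule G.subgroup_imp_normal[OF H])
  have \<Gamma>_sub: "b \<in> carrier B" if "h \<in> carrier G" "b \<in> \<Gamma> h" for h b
    using LinearCombinations.submodule.subset[OF \<Gamma>.component_subspace[OF that(1)]] that(2) by blast
  have gsG: "gs ! i \<in> carrier G" if "i < n" for i
    using gs that by (metis nth_mem subsetD)
  have coset_deg: "H #>\<^bsub>G\<^esub> (gs ! i \<otimes>\<^bsub>G\<^esub> h \<otimes>\<^bsub>G\<^esub> inv\<^bsub>G\<^esub> (gs ! j))
      = (H #>\<^bsub>G\<^esub> gs ! i) \<otimes>\<^bsub>G Mod H\<^esub> inv\<^bsub>G Mod H\<^esub> (H #>\<^bsub>G\<^esub> gs ! j)"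
    if "i < n" "j < n" "h \<in> H" for i j h
  proof -
    have c: "gs ! i \<in> carrier G" "gs ! j \<in> carrier G" "h \<in> carrier G"
      using that gsG H.mem_carrier by auto
    have "gs ! i \<otimes>\<^bsub>G\<^esub> h \<otimes>\<^bsub>G\<^esub> inv\<^bsub>G\<^esub> (gs ! j) = h \<otimes>\<^bsub>G\<^esub> (gs ! i \<otimes>\<^bsub>G\<^esub> inv\<^bsub>G\<^esub> (gs ! j))"
      using c by (simp add: G.m_comm[of "gs ! i" h] G.m_assoc)
    then have "H #>\<^bsub>G\<^esub> (gs ! i \<otimes>\<^bsub>G\<^esub> h \<otimes>\<^bsub>G\<^esub> inv\<^bsub>G\<^esub> (gs ! j))
        = (H #>\<^bsub>G\<^esub> h) #>\<^bsub>G\<^esub> (gs ! i \<otimes>\<^bsub>G\<^esub> inv\<^bsub>G\<^esub> (gs ! j))"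
      using c H.subset by (simp add: G.coset_mult_assoc)
    also have "H #>\<^bsub>G\<^esub> h = H" using that(3) by (rule H.rcos_const[OF G.is_group])
    also have "H #>\<^bsub>G\<^esub> (gs ! i \<otimes>\<^bsub>G\<^esub> inv\<^bsub>G\<^esub> (gs ! j))
        = (H #>\<^bsub>G\<^esub> gs ! i) <#>\<^bsub>G\<^esub> (H #>\<^bsub>G\<^esub> inv\<^bsub>G\<^esub> (gs ! j))"
      using c by (simp add: H.rcos_sum)
    also have "H #>\<^bsub>G\<^esub> inv\<^bsub>G\<^esub> (gs ! j) = inv\<^bsub>G Mod H\<^esub> (H #>\<^bsub>G\<^esub> gs ! j)"
      using c by (subst H.inv_FactGroup) (auto simp: FactGroup_def RCOSETS_def H.rcos_inv)
    finally show ?thesis by simp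
  qed
  let ?S = "\<Union>g \<in> {g \<in> carrier G. H #>\<^bsub>G\<^esub> g = q}. tensor_grading G d gs B \<Gamma> g"
  let ?gen = "\<lambda>g. {pure_tensor A B (unit_mat n i j) b | i j h b.
      i < n \<and> j < n \<and> (unit_mat n i j :: 'k mat) \<in> carrier A \<and> h \<in> carrier G \<and> b \<in> \<Gamma> h \<and>
      gs ! i \<otimes>\<^bsub>G\<^esub> h \<otimes>\<^bsub>G\<^esub> inv\<^bsub>G\<^esub> (gs ! j) = g}"
  have gen_sub: "?gen g \<subseteq> carrier R" for g
    using \<Gamma>_sub by (auto intro!: pure_R)
  have "lin_span R ?S = component ?D"
  proof (rule span_eq_componentI)
    show "?S \<subseteq> component ?D"
    proof (rule UN_least)
      fix g assume g: "g \<in> {g \<in> carrier G. H #>\<^bsub>G\<^esub> g = q}"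
      have "?gen g \<subseteq> component ?D"
      proof
        fix x assume x: "x \<in> ?gen g"
        then obtain i j h b where *: "x = pure_tensor A B (unit_mat n i j) b" "i < n" "j < n"
          "(unit_mat n i j :: 'k mat) \<in> carrier A" "h \<in> carrier G" "b \<in> \<Gamma> h"
          "gs ! i \<otimes>\<^bsub>G\<^esub> h \<otimes>\<^bsub>G\<^esub> inv\<^bsub>G\<^esub> (gs ! j) = g" by blast
        have ij: "(i, j) \<in> upper_pairs d" using * by (simp add: unit_mat_UT)
        have b: "b \<in> carrier B" using * \<Gamma>_sub by blast
        have e: "tensor_entry x p = (if p = (i, j) then b else \<zero>\<^bsub>B\<^esub>)" for p
          using entry_pure[OF ij b, of p] *(1) by simp
        \<comment> \<open>Off the support the components of B are zero, so a generator with h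
          outside H is the zero tensor and lies in every component.\<close>
        have b0: "b = \<zero>\<^bsub>B\<^esub>" if "h \<notin> H"
          using that supp *(5,6) by (auto simp: grading_support_def)
        have D: "(i, j) \<in> ?D" if "h \<in> H"
          using coset_deg[OF *(2,3) that, unfolded *(7)] g ij
          by (simp only: mem_Collect_eq case_prod_conv)
        have "tensor_entry x p = \<zero>\<^bsub>B\<^esub>" if p: "p \<notin> ?D" for p
        proof (cases "p = (i, j)")
          case True
          then have "h \<notin> H" using D p by blast
          then show ?thesis by (simp add: e b0)
        qed (simp add: e)
        then show "x \<in> component ?D" using subsetD[OF gen_sub x] by (simp add: component_def)
      qed
      then show "tensor_grading G d gs B \<Gamma> g \<subseteq> component ?D"
        unfolding tensor_grading_def by (rule R.span_is_subset[OF _ submodule_component])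
    qed
    then have S: "?S \<subseteq> carrier R" by (auto simp: component_def)
    have span: "LinearCombinations.submodule class_ring (lin_span R ?S) R"
      by (rule R.span_is_submodule[OF S])
    fix x assume x: "x \<in> component ?D"
    then have xR: "x \<in> carrier R" by (simp add: component_def)
    have D: "?D \<subseteq> upper_pairs d" "finite ?D"
      using finite_upper_pairs by (auto intro: finite_subset[rotated])
    have pure_span: "pure_tensor A B (E p) b \<in> lin_span R ?S" if p: "p \<in> ?D" and b: "b \<in> carrier B" for p b
    proof -
      \<comment> \<open>Generators of the grading are built from homogeneous elements only; the
        decomposition of b provides finitely many of them.\<close>
      obtain c where c: "c \<in> (\<Pi>\<^sub>E g \<in> carrier G. \<Gamma> g)" "finite {g \<in> carrier G. c g \<noteq> \<zero>\<^bsub>B\<^esub>}"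
        "b = (\<Oplus>\<^bsub>B\<^esub>g \<in> {g \<in> carrier G. c g \<noteq> \<zero>\<^bsub>B\<^esub>}. c g)"
        using \<Gamma>.direct[OF b] by blast
      let ?C = "{g \<in> carrier G. c g \<noteq> \<zero>\<^bsub>B\<^esub>}"
      have cg: "c g \<in> \<Gamma> g" "c g \<in> carrier B" "g \<in> H" if "g \<in> ?C" for g
      proof -
        show "c g \<in> \<Gamma> g" using c(1) that by auto
        then show "c g \<in> carrier B" "g \<in> H"
          using that \<Gamma>_sub supp by (auto simp: grading_support_def)
      qed
      have pT: "p \<in> upper_pairs d" using p D(1) by blast
      have pn: "fst p < n" "snd p < n" using upper_pairs_square[OF pT] by auto
      have "pure_tensor A B (E p) b = (\<Oplus>\<^bsub>R\<^esub>g\<in>?C. pure_tensor A B (E p) (c g))"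
      proof (rule entry_inj)
        have pc: "(\<lambda>g. pure_tensor A B (E p) (c g)) \<in> ?C \<rightarrow> carrier R"
          by (intro Pi_I pure_R E_A pT cg(2))
        then show "(\<Oplus>\<^bsub>R\<^esub>g\<in>?C. pure_tensor A B (E p) (c g)) \<in> carrier R"
          by (rule R.finsum_closed)
        fix r
        have "tensor_entry (\<Oplus>\<^bsub>R\<^esub>g\<in>?C. pure_tensor A B (E p) (c g)) r
            = (\<Oplus>\<^bsub>B\<^esub>g\<in>?C. tensor_entry (pure_tensor A B (E p) (c g)) r)"
          by (rule entry_finsum[OF c(2) pc])
        also have "\<dots> = (\<Oplus>\<^bsub>B\<^esub>g\<in>?C. if r = p then c g else \<zero>\<^bsub>B\<^esub>)"
        proof (rule B.finsum_cong'[OF refl])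
          show "(\<lambda>g. if r = p then c g else \<zero>\<^bsub>B\<^esub>) \<in> ?C \<rightarrow> carrier B"
          proof (rule Pi_I)
            fix g assume "g \<in> ?C"
            then show "(if r = p then c g else \<zero>\<^bsub>B\<^esub>) \<in> carrier B"
              using cg(2) B.zero_closed by presburger
          qed
          fix g assume "g \<in> ?C"
          then show "tensor_entry (pure_tensor A B (E p) (c g)) r = (if r = p then c g else \<zero>\<^bsub>B\<^esub>)"
            by (intro entry_pure pT cg(2))
        qed
        also have "\<dots> = (if r = p then b else \<zero>\<^bsub>B\<^esub>)"
          by (subst c(3)) simp
        finally show "tensor_entry (pure_tensor A B (E p) b) r
            = tensor_entry (\<Oplus>\<^bsub>R\<^esub>g\<in>?C. pure_tensor A B (E p) (c g)) r"
          using entry_pure[OF pT b, of r] by simp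
      qed (intro pure_R E_A pT b)
      also have "\<dots> \<in> lin_span R ?S"
      proof (rule R.finsum_in_submodule[OF span c(2)], rule Pi_I)
        fix h assume h: "h \<in> ?C"
        let ?g = "gs ! fst p \<otimes>\<^bsub>G\<^esub> h \<otimes>\<^bsub>G\<^esub> inv\<^bsub>G\<^esub> (gs ! snd p)"
        have "pure_tensor A B (E p) (c h) \<in> ?gen ?g"
          using h pn cg(1)[OF h] E_A[OF pT] by blast
        then have "pure_tensor A B (E p) (c h) \<in> tensor_grading G d gs B \<Gamma> ?g"
          unfolding tensor_grading_def using R.in_own_span[OF gen_sub] by blast
        moreover have "?g \<in> carrier G" using h pn gsG by auto
        \<comment> \<open>The degree \<open>?g\<close> varies with h, but its coset does not, so all
          pieces fall into the same coarse component.\<close>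
        moreover have "H #>\<^bsub>G\<^esub> ?g = q"
          using coset_deg[OF pn cg(3)[OF h]] p by (auto simp: case_prod_beta)
        ultimately have "pure_tensor A B (E p) (c h) \<in> ?S" by blast
        then show "pure_tensor A B (E p) (c h) \<in> lin_span R ?S"
          using R.in_own_span[OF S] by blast
      qed
      finally show ?thesis .
    qed
    \<comment> \<open>The element is rebuilt from its entries on \<open>?D\<close>; at positions
      outside \<open>?D\<close> both sides vanish.\<close>
    have "x = (\<Oplus>\<^bsub>R\<^esub>p\<in>?D. pure_tensor A B (E p) (tensor_entry x p))"
    proof (rule entry_inj[OF xR])
      have pc: "(\<lambda>p. pure_tensor A B (E p) (tensor_entry x p)) \<in> ?D \<rightarrow> carrier R"
        using D(1) by (auto intro!: pure_R E_A entry_closed xR)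
      then show "(\<Oplus>\<^bsub>R\<^esub>p\<in>?D. pure_tensor A B (E p) (tensor_entry x p)) \<in> carrier R"
        by (rule R.finsum_closed)
      fix r
      have "tensor_entry (\<Oplus>\<^bsub>R\<^esub>p\<in>?D. pure_tensor A B (E p) (tensor_entry x p)) r
          = (\<Oplus>\<^bsub>B\<^esub>p\<in>?D. tensor_entry (pure_tensor A B (E p) (tensor_entry x p)) r)"
        by (rule entry_finsum[OF D(2) pc])
      also have "\<dots> = (\<Oplus>\<^bsub>B\<^esub>p\<in>?D. if r = p then tensor_entry x p else \<zero>\<^bsub>B\<^esub>)"
      proof (rule B.finsum_cong'[OF refl])
        show "(\<lambda>p. if r = p then tensor_entry x p else \<zero>\<^bsub>B\<^esub>) \<in> ?D \<rightarrow> carrier B"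
          by (simp add: entry_closed xR)
        fix p assume "p \<in> ?D"
        then have "p \<in> upper_pairs d" using D(1) by blast
        then show "tensor_entry (pure_tensor A B (E p) (tensor_entry x p)) r
            = (if r = p then tensor_entry x p else \<zero>\<^bsub>B\<^esub>)"
          by (intro entry_pure entry_closed xR)
      qed
      also have "\<dots> = tensor_entry x r"
      proof (cases "r \<in> ?D")
        case True
        then show ?thesis using D(2) by (intro B.finsum_singleton) (auto intro: entry_closed xR)
      next
        case False
        then have "(\<Oplus>\<^bsub>B\<^esub>p\<in>?D. if r = p then tensor_entry x p else \<zero>\<^bsub>B\<^esub>) = (\<Oplus>\<^bsub>B\<^esub>p\<in>?D. \<zero>\<^bsub>B\<^esub>)"
          by (intro B.finsum_cong') auto
        moreover have "tensor_entry x r = \<zero>\<^bsub>B\<^esub>"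
          using x False by (rule component_zero)
        ultimately show ?thesis by (simp only: B.finsum_zero)
      qed
      finally show "tensor_entry x r
        = tensor_entry (\<Oplus>\<^bsub>R\<^esub>p\<in>?D. pure_tensor A B (E p) (tensor_entry x p)) r" ..
    qed
    also have "\<dots> \<in> lin_span R ?S"
      by (rule R.finsum_in_submodule[OF span D(2)]) (intro Pi_I pure_span entry_closed xR)
    finally show "x \<in> lin_span R ?S" .
  qed
  then show ?thesis by (simp add: coarsening_def)
qed

end

theorem lemma6:
  fixes G :: "('g, 'm) monoid_scheme"
    and H :: "'g set"
    and B :: "('k :: {alg_closed_field, field_char_0}, 'b) module"
    and \<Gamma> :: "'g \<Rightarrow> 'b set"
    and d :: "nat list"
    and gs :: "'g list"
    and t :: nat
  assumes "comm_group G"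
    and "d \<noteq> []" and "\<forall>k \<in> set d. 0 < k"
    and "length gs = sum_list d" and "set gs \<subseteq> carrier G"
    and "graded_algebra G B \<Gamma>"
    and "0 < t"
    and "ordinary_identities B = ordinary_identities (module_mat TYPE('k) t t)"
    and "subgroup H G"
    and "grading_support G B \<Gamma> = H"
  shows
    "graded_identities (G Mod H)
       (tensor_algebra (UT d) B)
       (coarsening G (\<lambda>g. H #>\<^bsub>G\<^esub> g) (tensor_algebra (UT d) B) (tensor_grading G d gs B \<Gamma>)) =
     graded_identities (G Mod H)
       (UT (map (\<lambda>k. k * t) d))
       (elementary_grading (G Mod H) (map (\<lambda>k. k * t) d)
         (concat (map (\<lambda>g. replicate t (H #>\<^bsub>G\<^esub> g)) gs)))"
proof -
  interpret \<Gamma>: graded_algebra G B \<Gamma> by fact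
  interpret tensor_UT B d by unfold_locales
  let ?Q = "G Mod H" and ?h = "\<lambda>i. H #>\<^bsub>G\<^esub> gs ! i"
  \<comment> \<open>The same set of positions arises on both sides: in the tensor grading because H
    absorbs the degrees of B, in the elementary grading because each coset is repeated t
    times.\<close>
  let ?D = "\<lambda>q. {(i, j) \<in> upper_pairs d. ?h i \<otimes>\<^bsub>?Q\<^esub> inv\<^bsub>?Q\<^esub> (?h j) = q}"
  have UT: "elementary_grading ?Q (map (\<lambda>k. k * t) d) (concat (map (\<lambda>g. replicate t (H #>\<^bsub>G\<^esub> g)) gs)) q
    = matrix_coordinates.component (UT (map (\<lambda>k. k * t) d) :: ('k, 'k mat) module)
        (module_mat TYPE('k) t t) (block_entry d t) (?D q)" for q
    using assms(4) by (intro elementary_grading_UT[OF assms(7)] nth_concat_replicate) auto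
  have D: "?D q \<subseteq> upper_pairs d" for q by auto
  note R = matrix_coordinates_axioms and M = matrix_coordinates_UT[OF assms(7), of d]
  note tensor = coarsening_tensor_grading[OF assms(1,4-6,9,10)]
  show ?thesis
  proof (rule equalityI)
    show "graded_identities ?Q R (coarsening G (\<lambda>g. H #>\<^bsub>G\<^esub> g) R (tensor_grading G d gs B \<Gamma>))
      \<subseteq> graded_identities ?Q (UT (map (\<lambda>k. k * t) d))
          (elementary_grading ?Q (map (\<lambda>k. k * t) d) (concat (map (\<lambda>g. replicate t (H #>\<^bsub>G\<^esub> g)) gs)))"
      by (rule graded_identities_matrix_coordinates_le[where D = ?D, OF R M D D tensor UT])
        (rule equalityD1[OF assms(8)])
    show "graded_identities ?Q (UT (map (\<lambda>k. k * t) d))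
          (elementary_grading ?Q (map (\<lambda>k. k * t) d) (concat (map (\<lambda>g. replicate t (H #>\<^bsub>G\<^esub> g)) gs)))
      \<subseteq> graded_identities ?Q R (coarsening G (\<lambda>g. H #>\<^bsub>G\<^esub> g) R (tensor_grading G d gs B \<Gamma>))"
      by (rule graded_identities_matrix_coordinates_le[where D = ?D, OF M R D D UT tensor])
        (rule equalityD2[OF assms(8)])
  qed
qed

end
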